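(* Let $G(q)$ be a $q$-continued fraction of the form described in the context, satisfying all the assumptions (i)--(v) listed there (with the associated $k$, $d$, $s$, $\eta$, $r$, $u$ and $H(q)=q^{\eta}/G(q)$). Then there exist an integer $N'$ and a strictly increasing function $\gamma:\mathbb{N}\to\mathbb{N}$ such that the following hold. (1) Let $t\in(0,1)$ be any irrational number, with regular continued fraction expansion $t=[0,e_1,e_2,\ldots]$ and approximants $c_n/d_n$, for which there exist two (infinite) subsequences of approximants $\{c_{f_n}/d_{f_n}\}_n$ and $\{c_{g_n}/d_{g_n}\}_n$ satisfying $$c_{f_n}\equiv r \pmod d,\quad d_{f_n}\equiv s \pmod d,\quad c_{g_n}\equiv u \pmod d,\quad d_{g_n}\equiv s \pmod d$$ and $$e_{h_n+1}>2\pi\,\gamma\!\left(k\,N'\,d_{h_n}^{2}\right)$$ for all $n$, where $h_n=f_n$ or $g_n$ (i.e. the inequality holds for both subsequences). Then $H(\exp(2\pi i t))$ does not converge generally. (2) Let $S^{\diamond}$ be the set of all irrational $t\in(0,1)$ satisfying the hypotheses in (1), and let $Y_G=\{\exp(2\pi i t): t\in S^{\diamond}\}$. Then $Y_G$ is an uncountable subset of the unit circle of measure zero.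
   Context: Continued fraction. Fix an integer $k\ge 1$ and polynomials $f_1,\dots,f_k,g_0,\dots,g_{k-1}\in\mathbb{Z}[q][x]$. For $n\ge 0$ and $1\le\sigma\le k$ put $a_{nk+\sigma}(q)=f_{\sigma}(q^{n})$ and $b_{nk+\sigma-1}(q)=g_{\sigma-1}(q^{n})$ (i.e. $x=q^n$ is substituted; the coefficients also depend on $q$). Let $G(q)=b_0(q)+K_{n=1}^{\infty}\frac{a_n(q)}{b_n(q)}$. Its approximants are $G_n(q)=P_n(q)/Q_n(q)$, where $P_{-1}=1$, $Q_{-1}=0$, $P_0=b_0$, $Q_0=1$, and $P_n=b_nP_{n-1}+a_nP_{n-2}$, $Q_n=b_nQ_{n-1}+a_nQ_{n-2}$ for $n\ge1$. $G(q)$ converges if $\lim_n P_n(q)/Q_n(q)$ exists (as a finite complex number), and the limit is also denoted $G(q)$. Powers. For a point on the unit circle presented as $q=\exp(2\pi i\tau)$ with $\tau$ real, $q^{\eta}$ means $\exp(2\pi i\eta\tau)$; thus $H(\exp(2\pi i h/m))=\exp(2\pi i\eta h/m)/G(\exp(2\pi i h/m))$ depends on the fraction $h/m$. Assumptions on $G$. (i) There are a positive integer $d$ and $s\in\{1,\dots,d\}$ such that if $m\ge1$, $m\equiv s\pmod d$, $\gcd(h,m)=1$ and $q=\exp(2\pi i h/m)$, then $a_n(q)\ne0$ for all $n\ge1$, $G(q)$ converges and $G(q)\neq0$. (ii) If $\exp(2\pi i h/m)$ is a primitive $m$-th root of unity, $\exp(2\pi i h'/m')$ is a primitive $m'$-th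 root of unity, $m\equiv m'\pmod d$, $h\equiv h'\pmod d$ and $G$ converges at $\exp(2\pi i h/m)$, then $G$ converges at $\exp(2\pi i h'/m')$. (iii) There is $\eta\in\mathbb{Q}$ such that, with $H(q):=q^{\eta}/G(q)$, in the situation of (ii) one has $H(\exp(2\pi i h/m))=H(\exp(2\pi i h'/m'))$. (Consequently $H$ takes only finitely many values at roots of unity; call them $H_1,\dots,H_{N_G}$.) (iv) There are integers $K_0,\dots,K_4$ (depending only on $s$) such that for every $m\equiv s\pmod d$ and every primitive $m$-th root of unity $q$: $a_{km}(q)=K_0$, $P_{km-1}(q)=K_1$, $Q_{km-2}(q)=K_2$, $Q_{km-1}(q)P_{km-2}(q)=K_3$, $|Q_{km-1}(q)|=|P_{km-2}(q)|=K_4$. (v) There are $r\neq u$ in $\{0,1,\dots,d-1\}$ such that $H(\exp(2\pi i r/s))=H_a\neq H_b=H(\exp(2\pi i u/s))$ for some $a,b\in\{1,\dots,N_G\}$. General convergence. The chordal metric on $\hat{\mathbb{C}}$ is $\rho(w,z)=\frac{|z-w|}{\sqrt{1+|w|^2}\sqrt{1+|z|^2}}$ for finite $w,z$ and $\rho(w,\infty)=1/\sqrt{1+|w|^2}$. A continued fraction with $n$-th approximant $A_n/B_n$ converges generally to $f\in\hat{\mathbb{C}}$ if there are sequences $\{v_n\},\{w_n\}\subset\hat{\mathbb{C}}$ with $\liminf \rho(v_n,w_n)>0$ and $\lim_n S_n(v_n)=\lim_n S_n(w_n)=f$, where $S_n(w)=\frac{A_n+wA_{n-1}}{B_n+wB_{n-1}}$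 (and $S_n(\infty)=A_{n-1}/B_{n-1}$). For $y=\exp(2\pi i t)$, $t\in(0,1)$, "$H(y)$ converges generally" means there are such $v_n,w_n$ for which $y^{\eta}\frac{Q_n(y)+v_nQ_{n-1}(y)}{P_n(y)+v_nP_{n-1}(y)}$ and $y^{\eta}\frac{Q_n(y)+w_nQ_{n-1}(y)}{P_n(y)+w_nP_{n-1}(y)}$ tend to a common limit in $\hat{\mathbb C}$; equivalently, $G(y)$ converges generally.
   Formalization: In (v), r and u are additionally required to be coprime to s, so that exp(2πi r/s) and exp(2πi u/s) are primitive s-th roots of unity; otherwise, e.g. Rogers–Ramanujan with d=10, s=6, r=0, u=2, the set Y_G is empty and (2) fails. *)

theory Defs
  imports
    "HOL-Analysis.Analysis"
    "HOL-Computational_Algebra.Polynomial"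
    "HOL-Number_Theory.Cong"
begin

section \<open>Continued fractions\<close>

text \<open>
  For the continued fraction with partial numerators \<open>a 1, a 2, \<dots>\<close> and partial
  denominators \<open>b 0, b 1, \<dots>\<close>, the auxiliary functions hold the canonical numerators and
  denominators shifted by one place. The versions with integer index undo the shift, so
  that they start at index \<open>-1\<close>. The value \<open>a 0\<close> is never used.
\<close>

fun cf_num_shift :: "(nat \<Rightarrow> 'a::comm_semiring_1) \<Rightarrow> (nat \<Rightarrow> 'a) \<Rightarrow> nat \<Rightarrow> 'a" where
  "cf_num_shift a b 0 = 1"
| "cf_num_shift a b (Suc 0) = b 0"
| "cf_num_shift a b (Suc (Suc n)) =
     b (Suc n) * cf_num_shift a b (Suc n) + a (Suc n) * cf_num_shift a b n"

fun cf_den_shift :: "(nat \<Rightarrow> 'a::comm_semiring_1) \<Rightarrow> (nat \<Rightarrow> 'a) \<Rightarrow> nat \<Rightarrow> 'a" where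
  "cf_den_shift a b 0 = 0"
| "cf_den_shift a b (Suc 0) = 1"
| "cf_den_shift a b (Suc (Suc n)) =
     b (Suc n) * cf_den_shift a b (Suc n) + a (Suc n) * cf_den_shift a b n"

definition cf_num :: "(nat \<Rightarrow> 'a::comm_semiring_1) \<Rightarrow> (nat \<Rightarrow> 'a) \<Rightarrow> int \<Rightarrow> 'a" where
  "cf_num a b n = cf_num_shift a b (nat (n + 1))"

definition cf_den :: "(nat \<Rightarrow> 'a::comm_semiring_1) \<Rightarrow> (nat \<Rightarrow> 'a) \<Rightarrow> int \<Rightarrow> 'a" where
  "cf_den a b n = cf_den_shift a b (nat (n + 1))"

lemma cf_num_rec:
  "cf_num a b (-1) = 1" "cf_num a b 0 = b 0"
  "n \<ge> 1 \<Longrightarrow> cf_num a b (int n) = b n * cf_num a b (int n - 1) + a n * cf_num a b (int n - 2)"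
  by (cases n; simp add: cf_num_def nat_add_distrib)+

lemma cf_den_rec:
  "cf_den a b (-1) = 0" "cf_den a b 0 = 1"
  "n \<ge> 1 \<Longrightarrow> cf_den a b (int n) = b n * cf_den a b (int n - 1) + a n * cf_den a b (int n - 2)"
  by (cases n; simp add: cf_den_def nat_add_distrib)+

text \<open>
  Classical convergence of the approximants \<open>A n / B n\<close> to a finite limit. The first conjunct
  rules out the artefact \<open>x / 0 = 0\<close>: only finitely many approximants may be infinite.
\<close>

definition cf_converges :: "(int \<Rightarrow> complex) \<Rightarrow> (int \<Rightarrow> complex) \<Rightarrow> bool" where
  "cf_converges A B \<longleftrightarrow>
     (\<forall>\<^sub>F n in sequentially. B (int n) \<noteq> 0) \<and> convergent (\<lambda>n::nat. A (int n) / B (int n))"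

definition cf_value :: "(int \<Rightarrow> complex) \<Rightarrow> (int \<Rightarrow> complex) \<Rightarrow> complex" where
  "cf_value A B = lim (\<lambda>n::nat. A (int n) / B (int n))"


section \<open>General convergence\<close>

datatype ext_complex = Fin complex | Infty

fun chordal :: "ext_complex \<Rightarrow> ext_complex \<Rightarrow> real" where
  "chordal (Fin w) (Fin z) =
     cmod (z - w) / (sqrt (1 + (cmod w)\<^sup>2) * sqrt (1 + (cmod z)\<^sup>2))"
| "chordal (Fin w) Infty = 1 / sqrt (1 + (cmod w)\<^sup>2)"
| "chordal Infty (Fin z) = 1 / sqrt (1 + (cmod z)\<^sup>2)"
| "chordal Infty Infty = 0"

text \<open>
  The form \<open>0 / 0\<close>, which arises in \<open>cf_map\<close> only where the determinant
  \<open>A n * B (n - 1) - A (n - 1) * B n\<close> vanishes, is given the value \<open>Infty\<close>.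
\<close>

definition ext_div :: "complex \<Rightarrow> complex \<Rightarrow> ext_complex" where
  "ext_div x y = (if y = 0 then Infty else Fin (x / y))"

fun cf_map :: "(int \<Rightarrow> complex) \<Rightarrow> (int \<Rightarrow> complex) \<Rightarrow> nat \<Rightarrow> ext_complex \<Rightarrow> ext_complex" where
  "cf_map A B n (Fin w) =
     ext_div (A (int n) + w * A (int n - 1)) (B (int n) + w * B (int n - 1))"
| "cf_map A B n Infty = ext_div (A (int n - 1)) (B (int n - 1))"

definition converges_generally :: "(int \<Rightarrow> complex) \<Rightarrow> (int \<Rightarrow> complex) \<Rightarrow> bool" where
  "converges_generally A B \<longleftrightarrow>
     (\<exists>(l :: ext_complex) (v :: nat \<Rightarrow> ext_complex) (w :: nat \<Rightarrow> ext_complex).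
        liminf (\<lambda>n. ereal (chordal (v n) (w n))) > 0 \<and>
        (\<lambda>n. chordal (cf_map A B n (v n)) l) \<longlonglongrightarrow> 0 \<and>
        (\<lambda>n. chordal (cf_map A B n (w n)) l) \<longlonglongrightarrow> 0)"


section \<open>The q-continued fraction\<close>

definition unit_exp :: "real \<Rightarrow> complex" where
  "unit_exp \<tau> = exp (2 * of_real pi * \<i> * of_real \<tau>)"

text \<open>Here the outer variable of the polynomial is \<open>x\<close> and the coefficients lie in \<open>\<int>[q]\<close>.\<close>

definition eval_qx :: "int poly poly \<Rightarrow> complex \<Rightarrow> complex \<Rightarrow> complex" where
  "eval_qx p q x = poly (map_poly (\<lambda>c. poly (map_poly of_int c) q) p) x"

text \<open>
  The families \<open>f\<close> and \<open>g\<close> are used at the indices \<open>1, \<dots>, k\<close> and \<open>0, \<dots>, k - 1\<close>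
  respectively; \<open>qcf_a\<close> is used at positive indices only.
\<close>

definition qcf_a :: "nat \<Rightarrow> (nat \<Rightarrow> int poly poly) \<Rightarrow> complex \<Rightarrow> nat \<Rightarrow> complex" where
  "qcf_a k f q N = eval_qx (f ((N - 1) mod k + 1)) q (q ^ ((N - 1) div k))"

definition qcf_b :: "nat \<Rightarrow> (nat \<Rightarrow> int poly poly) \<Rightarrow> complex \<Rightarrow> nat \<Rightarrow> complex" where
  "qcf_b k g q N = eval_qx (g (N mod k)) q (q ^ (N div k))"

lemma qcf_a_index:
  assumes "1 \<le> \<sigma>" "\<sigma> \<le> k"
  shows "qcf_a k f q (n * k + \<sigma>) = eval_qx (f \<sigma>) q (q ^ n)"
proof -
  obtain j where "\<sigma> = Suc j" "j < k" using assms by (cases \<sigma>) auto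
  then show ?thesis by (simp add: qcf_a_def)
qed

lemma qcf_b_index:
  assumes "1 \<le> \<sigma>" "\<sigma> \<le> k"
  shows "qcf_b k g q (n * k + \<sigma> - 1) = eval_qx (g (\<sigma> - 1)) q (q ^ n)"
proof -
  obtain j where "\<sigma> = Suc j" "j < k" using assms by (cases \<sigma>) auto
  then show ?thesis by (simp add: qcf_b_def)
qed

definition qcf_P ::
  "nat \<Rightarrow> (nat \<Rightarrow> int poly poly) \<Rightarrow> (nat \<Rightarrow> int poly poly) \<Rightarrow> complex \<Rightarrow> int \<Rightarrow> complex" where
  "qcf_P k f g q = cf_num (qcf_a k f q) (qcf_b k g q)"

definition qcf_Q ::
  "nat \<Rightarrow> (nat \<Rightarrow> int poly poly) \<Rightarrow> (nat \<Rightarrow> int poly poly) \<Rightarrow> complex \<Rightarrow> int \<Rightarrow> complex" where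
  "qcf_Q k f g q = cf_den (qcf_a k f q) (qcf_b k g q)"

definition G_converges ::
  "nat \<Rightarrow> (nat \<Rightarrow> int poly poly) \<Rightarrow> (nat \<Rightarrow> int poly poly) \<Rightarrow> complex \<Rightarrow> bool" where
  "G_converges k f g q \<longleftrightarrow> cf_converges (qcf_P k f g q) (qcf_Q k f g q)"

definition G_val ::
  "nat \<Rightarrow> (nat \<Rightarrow> int poly poly) \<Rightarrow> (nat \<Rightarrow> int poly poly) \<Rightarrow> complex \<Rightarrow> complex" where
  "G_val k f g q = cf_value (qcf_P k f g q) (qcf_Q k f g q)"

text \<open>
  The value of \<open>H\<close> at \<open>exp (2 \<pi> \<i> \<tau>)\<close>, which depends on \<open>\<tau>\<close> through the power
  \<open>q powr \<eta>\<close>. Where \<open>G\<close> converges to \<open>0\<close>, so that \<open>H\<close> is infinite, this is \<open>0\<close>; as \<open>H\<close> is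
  nonzero wherever \<open>G\<close> has a finite nonzero value, equality of values of \<open>H_val\<close> agrees with
  equality on the Riemann sphere.
\<close>

definition H_val ::
  "nat \<Rightarrow> (nat \<Rightarrow> int poly poly) \<Rightarrow> (nat \<Rightarrow> int poly poly) \<Rightarrow> rat \<Rightarrow> real \<Rightarrow> complex" where
  "H_val k f g \<eta> \<tau> = unit_exp (of_rat \<eta> * \<tau>) / G_val k f g (unit_exp \<tau>)"

text \<open>The approximants of \<open>H\<close> are \<open>q powr \<eta> * Q n / P n\<close>.\<close>

definition H_converges_generally ::
  "nat \<Rightarrow> (nat \<Rightarrow> int poly poly) \<Rightarrow> (nat \<Rightarrow> int poly poly) \<Rightarrow> rat \<Rightarrow> real \<Rightarrow> bool" where
  "H_converges_generally k f g \<eta> t \<longleftrightarrow>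
     converges_generally
       (\<lambda>n. unit_exp (of_rat \<eta> * t) * qcf_Q k f g (unit_exp t) n)
       (qcf_P k f g (unit_exp t))"


section \<open>Regular continued fractions\<close>

text \<open>
  The regular continued fraction of an irrational \<open>t > 0\<close>: the complete quotients are
  iterates of \<open>x \<mapsto> 1 / frac x\<close>, and the partial quotients are their integer parts.
\<close>

definition rcf_quot :: "real \<Rightarrow> nat \<Rightarrow> nat" where
  "rcf_quot t n = nat \<lfloor>((\<lambda>x. 1 / frac x) ^^ n) t\<rfloor>"

definition rcf_num :: "real \<Rightarrow> nat \<Rightarrow> nat" where
  "rcf_num t n = cf_num (\<lambda>_. 1) (rcf_quot t) (int n)"

definition rcf_den :: "real \<Rightarrow> nat \<Rightarrow> nat" where
  "rcf_den t n = cf_den (\<lambda>_. 1) (rcf_quot t) (int n)"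

definition S_diamond ::
  "nat \<Rightarrow> nat \<Rightarrow> nat \<Rightarrow> nat \<Rightarrow> nat \<Rightarrow> nat \<Rightarrow> (nat \<Rightarrow> nat) \<Rightarrow> real set" where
  "S_diamond k d s r u N' \<gamma> =
     {t. 0 < t \<and> t < 1 \<and> t \<notin> \<rat> \<and>
        (\<exists>F F' :: nat \<Rightarrow> nat. strict_mono F \<and> strict_mono F' \<and>
           (\<forall>n. [rcf_num t (F n) = r] (mod d) \<and> [rcf_den t (F n) = s] (mod d)) \<and>
           (\<forall>n. [rcf_num t (F' n) = u] (mod d) \<and> [rcf_den t (F' n) = s] (mod d)) \<and>
           (\<forall>n. \<forall>h \<in> {F n, F' n}.
              real (rcf_quot t (h + 1)) > 2 * pi * real (\<gamma> (k * N' * (rcf_den t h)\<^sup>2))))}"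


section \<open>Arc length on the unit circle\<close>

definition circle_measure :: "complex measure" where
  "circle_measure =
     completion (distr (restrict_space lborel {0..<2 * pi}) (restrict_space borel (sphere 0 1)) cis)"

lemma measurable_cis_circle:
  "cis \<in> measurable (restrict_space lborel {0..<2 * pi}) (restrict_space borel (sphere 0 1))"
proof -
  have "cis \<in> borel_measurable borel"
    by (intro borel_measurable_continuous_onI continuous_intros)
  then have "cis \<in> borel_measurable (restrict_space lborel {0..<2 * pi})"
    by (intro measurable_restrict_space1) simp
  then show ?thesis
    by (intro measurable_restrict_space2) (auto simp: space_restrict_space)
qed

lemma emeasure_circle: "emeasure circle_measure (sphere 0 1) = ennreal (2 * pi)"
proof -
  have sp: "sphere 0 1 \<in> sets (restrict_space borel (sphere (0::complex) 1))"
    using sets.top[of "restrict_space borel (sphere (0::complex) 1)"]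
    by (simp add: space_restrict_space)
  have "cis -` sphere 0 1 \<inter> space (restrict_space lborel {0..<2 * pi}) = {0..<2 * pi}"
    by (auto simp: space_restrict_space)
  then show ?thesis
    using sp by (simp add: circle_measure_def emeasure_distr[OF measurable_cis_circle]
      emeasure_restrict_space)
qed

end

theory Submission
  imports Defs
begin

text \<open>
  At a root of unity \<open>q = exp (2 \<pi> \<i> c / m)\<close> with \<open>m \<equiv> s\<close> the approximants of \<open>H\<close> converge to
  \<open>H (exp (2 \<pi> \<i> r / s))\<close> or \<open>H (exp (2 \<pi> \<i> u / s))\<close>, so two consecutive ones of index at least
  \<open>m\<close> are close to this value, and by continuity they stay close for \<open>t\<close> near \<open>c / m\<close>. Only
  finitely many \<open>c\<close> occur for a given \<open>m\<close>, hence a fast growing \<open>\<gamma>\<close> (with \<open>N' = 1\<close>) forces every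
  \<open>t\<close> in \<open>S_diamond\<close> into these neighbourhoods for infinitely many \<open>m\<close> of both kinds. If the
  continued fraction converges generally to \<open>l\<close>, then invariance of the cross ratio of
  \<open>0, \<infinity>, v n, w n\<close> under the Moebius maps \<open>S n\<close> shows that \<open>l\<close> is the common limit of
  \<open>S n 0\<close> and \<open>S n \<infinity>\<close> along any subsequence where these agree, so \<open>l\<close> would have two values.

  Since \<open>\<gamma> j \<ge> j\<close>, the elements of \<open>S_diamond\<close> are approximable to order 4, which gives measure zero
  by Borel--Cantelli. Uncountability is a diagonal argument: an initial segment of partial
  quotients can be continued to a convergent in any residue class \<open>(x, y)\<close> modulo \<open>d\<close> with
  \<open>x, y\<close> coprime, by running the Euclidean algorithm modulo \<open>d\<close>, and the next quotient may be
  arbitrarily large.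
\<close>

section \<open>Convergents of regular continued fractions\<close>

text \<open>With the shift by one, \<open>cnum e (Suc n)\<close> is the usual numerator of index
  \<open>n\<close>, and \<open>cnum e n\<close> depends only on the entries of \<open>e\<close>
  below \<open>n\<close>.\<close>

abbreviation cnum :: "(nat \<Rightarrow> nat) \<Rightarrow> nat \<Rightarrow> nat" where
  "cnum \<equiv> cf_num_shift (\<lambda>_. 1)"

abbreviation cden :: "(nat \<Rightarrow> nat) \<Rightarrow> nat \<Rightarrow> nat" where
  "cden \<equiv> cf_den_shift (\<lambda>_. 1)"

lemma rcf_num_eq: "rcf_num t n = cnum (rcf_quot t) (Suc n)"
  by (simp add: rcf_num_def cf_num_def nat_add_distrib)

lemma rcf_den_eq: "rcf_den t n = cden (rcf_quot t) (Suc n)"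
  by (simp add: rcf_den_def cf_den_def nat_add_distrib)

lemma cnum_cong: "(\<And>i. i < n \<Longrightarrow> e i = e' i) \<Longrightarrow> cnum e n = cnum e' n"
  by (induction n rule: induct_nat_012) auto

lemma cden_cong: "(\<And>i. i < n \<Longrightarrow> e i = e' i) \<Longrightarrow> cden e n = cden e' n"
  by (induction n rule: induct_nat_012) auto

lemma cnum_cden_det:
  "int (cnum e (Suc n)) * int (cden e n) - int (cnum e n) * int (cden e (Suc n)) = (- 1) ^ Suc n"
  by (induction n) (simp_all add: algebra_simps)

lemma coprime_cnum_cden: "coprime (cnum e n) (cden e n)"
proof (rule coprimeI)
  fix c assume c: "c dvd cnum e n" "c dvd cden e n"
  have "int c dvd int (cnum e (Suc n)) * int (cden e n) - int (cnum e n) * int (cden e (Suc n))"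
    using c by (intro dvd_diff dvd_mult dvd_mult2) auto
  then have "int c dvd (- 1) ^ Suc n" unfolding cnum_cden_det .
  then have "int c dvd 1" by (metis dvd_minus_iff minus_one_power_iff)
  then show "is_unit c" by simp
qed

lemma cden_pos:
  assumes "\<And>i. e (Suc i) \<ge> 1"
  shows "cden e (Suc n) \<ge> 1"
proof (induction n rule: induct_nat_012)
  case (ge2 n)
  then show ?case using assms[of "Suc n"] by (simp add: add_increasing2)
qed (use assms[of 0] in auto)

text \<open>Each step of the recurrence adds a positive earlier denominator. Hence convergents of
  large index have large denominators.\<close>

lemma cden_ge:
  assumes "\<And>i. e (Suc i) \<ge> 1"
  shows "cden e (Suc n) \<ge> n"
proof (induction n rule: induct_nat_012)
  case (ge2 n)
  have "1 * cden e (Suc (Suc n)) \<le> e (Suc (Suc n)) * cden e (Suc (Suc n))"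
    using assms[of "Suc n"] by (intro mult_right_mono) auto
  moreover have "cden e (Suc (Suc (Suc n))) =
      e (Suc (Suc n)) * cden e (Suc (Suc n)) + cden e (Suc n)" by simp
  ultimately show ?case using ge2 cden_pos[where e = e, OF assms, of n] by linarith
qed (use assms[of 0] in auto)

lemma cnum_le_cden:
  assumes "e 0 = 0" "\<And>i. e (Suc i) \<ge> 1"
  shows "cnum e (Suc n) \<le> cden e (Suc n)"
proof (induction n rule: induct_nat_012)
  case (ge2 n)
  then show ?case by (simp add: add_mono)
qed (use assms(1) assms(2)[of 0] in auto)

section \<open>Complete quotients and the approximation error\<close>

text \<open>Here \<open>X n\<close> plays the role of the \<open>n\<close>-th complete quotient of \<open>X 0\<close>.\<close>

lemma complete_quotient_value:
  fixes X :: "nat \<Rightarrow> real"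
  assumes rec: "\<And>n. X n = real (e n) + 1 / X (Suc n)" and pos: "\<And>n. X (Suc n) > 1"
  shows "X 0 * (X (Suc n) * cden e (Suc n) + cden e n) = X (Suc n) * cnum e (Suc n) + cnum e n"
proof (induction n)
  case 0
  have "X (Suc 0) > 0" using pos[of 0] by simp
  then show ?case using rec[of 0] by (simp add: field_simps)
next
  case (Suc n)
  have W: "X (Suc (Suc n)) > 0" using pos[of "Suc n"] by simp
  have Z: "X (Suc n) * X (Suc (Suc n)) = e (Suc n) * X (Suc (Suc n)) + 1"
    using rec[of "Suc n"] W by (simp add: field_simps)
  have "X 0 * (X (Suc n) * cden e (Suc n) + cden e n) * X (Suc (Suc n))
      = (X (Suc n) * cnum e (Suc n) + cnum e n) * X (Suc (Suc n))"
    using Suc by simp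
  then have "X 0 * ((X (Suc n) * X (Suc (Suc n))) * cden e (Suc n) + cden e n * X (Suc (Suc n)))
      = (X (Suc n) * X (Suc (Suc n))) * cnum e (Suc n) + cnum e n * X (Suc (Suc n))"
    by (simp add: algebra_simps)
  then show ?case unfolding Z by (simp add: algebra_simps)
qed

text \<open>Multiplying by the second factor and inserting \<open>complete_quotient_value\<close>
  cancels the complete quotient and leaves the determinant of consecutive convergents, which is
  \<open>1\<close> or \<open>- 1\<close>.\<close>

lemma convergent_error:
  fixes X :: "nat \<Rightarrow> real"
  assumes rec: "\<And>n. X n = real (e n) + 1 / X (Suc n)" and pos: "\<And>n. X (Suc n) > 1"
  shows "\<bar>X 0 * cden e (Suc n) - cnum e (Suc n)\<bar> * (X (Suc n) * cden e (Suc n) + cden e n) = 1"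
proof -
  let ?Z = "X (Suc n) * cden e (Suc n) + cden e n"
  have "(X 0 * cden e (Suc n) - cnum e (Suc n)) * ?Z =
      cden e (Suc n) * (X 0 * ?Z) - cnum e (Suc n) * ?Z"
    by (simp add: algebra_simps)
  also have "\<dots> = - (real (cnum e (Suc n)) * real (cden e n) - real (cnum e n) * real (cden e (Suc n)))"
    unfolding complete_quotient_value[where X = X and e = e, OF assms] by (simp add: algebra_simps)
  also have "\<dots> = - real_of_int
      (int (cnum e (Suc n)) * int (cden e n) - int (cnum e n) * int (cden e (Suc n)))"
    by simp
  also have "\<dots> = (- 1) ^ n" unfolding cnum_cden_det by simp
  finally have "\<bar>X 0 * cden e (Suc n) - cnum e (Suc n)\<bar> * \<bar>?Z\<bar> = 1"
    by (simp add: abs_mult [symmetric])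
  moreover have "?Z \<ge> 0" using pos[of n] by (intro add_nonneg_nonneg mult_nonneg_nonneg) auto
  ultimately show ?thesis by simp
qed

text \<open>Drops the term \<open>cden e n\<close> from the exact formula and bounds
  \<open>X (Suc n)\<close> below by its integer part. The next partial quotient thus controls the
  error, which is how a lower bound in terms of \<open>\<gamma>\<close> becomes closeness to a
  rational.\<close>

lemma convergent_error_le:
  fixes X :: "nat \<Rightarrow> real"
  assumes rec: "\<And>n. X n = real (e n) + 1 / X (Suc n)" and pos: "\<And>n. X (Suc n) > 1"
    and e: "\<And>i. e (Suc i) \<ge> 1"
  shows "\<bar>X 0 - real (cnum e (Suc n)) / real (cden e (Suc n))\<bar>
    \<le> 1 / (real (cden e (Suc n)) ^ 2 * real (e (Suc n)))"
proof -
  define D where "D = real (cden e (Suc n))"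
  define E where "E = \<bar>X 0 * D - cnum e (Suc n)\<bar>"
  have D: "D \<ge> 1" using cden_pos[where e = e, OF e, of n] by (simp add: D_def)
  have X: "X (Suc n) \<ge> e (Suc n)" using rec[of "Suc n"] pos[of "Suc n"] by simp
  have "E * (D * e (Suc n)) \<le> E * (X (Suc n) * D + cden e n)"
  proof (intro mult_left_mono)
    have "D * e (Suc n) \<le> D * X (Suc n)" using X D by (intro mult_left_mono) auto
    then show "D * e (Suc n) \<le> X (Suc n) * D + cden e n" by (simp add: mult.commute)
  qed (simp add: E_def)
  also have "\<dots> = 1" using convergent_error[where X = X and e = e, OF rec pos] by (simp add: E_def D_def)
  finally have "E * (D * e (Suc n)) \<le> 1" .
  moreover have "X 0 - cnum e (Suc n) / D = (X 0 * D - cnum e (Suc n)) / D"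
    using D by (simp add: diff_divide_distrib)
  then have "\<bar>X 0 - cnum e (Suc n) / D\<bar> = E / D"
    using D by (simp add: E_def abs_divide)
  ultimately show ?thesis using D e[of n] unfolding D_def[symmetric]
    by (simp add: field_simps power2_eq_square)
qed

text \<open>If \<open>X 0\<close> had denominator \<open>q\<close>, then \<open>q * E\<close> would
  be a nonzero integer, although \<open>E\<close> has absolute value \<open>1 / Z\<close> with
  \<open>Z\<close> as large as the denominators of the convergents.\<close>

lemma irrational_of_complete_quotients:
  fixes X :: "nat \<Rightarrow> real"
  assumes rec: "\<And>n. X n = real (e n) + 1 / X (Suc n)" and pos: "\<And>n. X (Suc n) > 1"
    and e: "\<And>i. e (Suc i) \<ge> 1"
  shows "X 0 \<notin> \<rat>"
proof
  assume "X 0 \<in> \<rat>"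
  then obtain p q :: int where q: "q > 0" and X: "X 0 = of_int p / of_int q"
    by (metis Rats_cases' of_int_0_less_iff)
  \<comment> \<open>By \<open>cden_ge\<close> this index already forces
    \<open>Z > q\<close>.\<close>
  define n where "n = nat q"
  define E where "E = X 0 * cden e (Suc n) - cnum e (Suc n)"
  define Z where "Z = X (Suc n) * cden e (Suc n) + cden e n"
  have EZ: "\<bar>E\<bar> * Z = 1" unfolding E_def Z_def by (rule convergent_error[where X = X and e = e, OF rec pos])
  have "1 * real (cden e (Suc n)) < X (Suc n) * cden e (Suc n)"
    using pos[of n] cden_pos[where e = e, OF e, of n] by (intro mult_strict_right_mono) auto
  then have Z: "Z > q" using cden_ge[where e = e, OF e, of n] q unfolding Z_def n_def by linarith
  define z where "z = p * int (cden e (Suc n)) - q * int (cnum e (Suc n))"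
  have z: "of_int q * E = of_int z"
    unfolding E_def X z_def using q by (simp add: field_simps)
  have "E \<noteq> 0" using EZ by auto
  with z q have "z \<noteq> 0" by auto
  then have "\<bar>z\<bar> \<ge> 1" by linarith
  then have "\<bar>of_int q * E\<bar> \<ge> 1" unfolding z by linarith
  then have "of_int q * \<bar>E\<bar> \<ge> 1" using q by (simp add: abs_mult)
  moreover have "of_int q * \<bar>E\<bar> < Z * \<bar>E\<bar>"
    using Z \<open>E \<noteq> 0\<close> by (intro mult_strict_right_mono) auto
  ultimately show False using EZ by (simp add: mult.commute)
qed

text \<open>Since \<open>1 / X (Suc n)\<close> lies strictly between 0 and 1, it is the fractional
  part of \<open>X n\<close>, so iterating the Gauss map from \<open>X 0\<close> runs through the
  sequence \<open>X\<close>.\<close>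

lemma rcf_quot_of_complete_quotients:
  fixes X :: "nat \<Rightarrow> real"
  assumes rec: "\<And>n. X n = real (e n) + 1 / X (Suc n)" and pos: "\<And>n. X (Suc n) > 1"
  shows "rcf_quot (X 0) = e"
proof
  have fl: "\<lfloor>X n\<rfloor> = int (e n)" for n
  proof (rule floor_unique)
    have "0 < 1 / X (Suc n)" "1 / X (Suc n) < 1" using pos[of n] by simp_all
    then show "of_int (int (e n)) \<le> X n" "X n < of_int (int (e n)) + 1"
      unfolding rec[of n] by linarith+
  qed
  have it: "((\<lambda>x. 1 / frac x) ^^ n) (X 0) = X n" for n
  proof (induction n)
    case (Suc n)
    have "frac (X n) = 1 / X (Suc n)" unfolding frac_def fl using rec[of n] by simp
    with Suc show ?case by simp
  qed simp
  show "rcf_quot (X 0) n = e n" for n by (simp add: rcf_quot_def it fl)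
qed

text \<open>Irrationality passes from a number to its fractional part and to the inverse, so no
  iterate has fractional part 0 and the division by it is always genuine.\<close>

lemma irrational_complete_quotients:
  fixes t :: real
  assumes t: "0 < t" "t \<notin> \<rat>"
  defines "X \<equiv> \<lambda>n. ((\<lambda>x. 1 / frac x) ^^ n) t"
  shows "X n = real (rcf_quot t n) + 1 / X (Suc n)" "X (Suc n) > 1" "rcf_quot t (Suc n) \<ge> 1"
proof -
  have irr: "X n \<notin> \<rat> \<and> X n > 0" for n
  proof (induction n)
    case 0
    then show ?case using t by (simp add: X_def)
  next
    case (Suc n)
    have "X n = frac (X n) + of_int \<lfloor>X n\<rfloor>" by (simp add: frac_def)
    with Suc have fr: "frac (X n) \<notin> \<rat>" using Rats_add[OF _ Rats_of_int] by metis
    then have "frac (X n) \<noteq> 0" by (metis Rats_0)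
    then have "frac (X n) > 0" using frac_ge_0[of "X n"] by linarith
    moreover have "inverse (frac (X n)) \<notin> \<rat>" using fr Rats_inverse by fastforce
    moreover have "X (Suc n) = inverse (frac (X n))" by (simp add: X_def inverse_eq_divide)
    ultimately show ?case by simp
  qed
  have fr: "frac (X n) > 0" for n
  proof -
    have "X n \<notin> \<int>" using irr[of n] Ints_subset_Rats by blast
    then show ?thesis by (simp add: frac_gt_0_iff)
  qed
  have S: "X (Suc n) = 1 / frac (X n)" for n by (simp add: X_def)
  show gt: "X (Suc n) > 1" for n
    using fr[of n] frac_lt_1[of "X n"] by (simp add: S)
  have "\<lfloor>X n\<rfloor> \<ge> 0" using irr[of n] by simp
  then show "X n = real (rcf_quot t n) + 1 / X (Suc n)"
    using fr[of n] by (simp add: rcf_quot_def X_def frac_def)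
  have "\<lfloor>X (Suc n)\<rfloor> \<ge> 1" using gt[of n] by (simp add: le_floor_iff)
  then show "rcf_quot t (Suc n) \<ge> 1" unfolding rcf_quot_def X_def by linarith
qed

lemma rcf_approx:
  assumes "0 < t" "t \<notin> \<rat>"
  shows "\<bar>t - real (rcf_num t n) / real (rcf_den t n)\<bar>
    \<le> 1 / (real (rcf_den t n) ^ 2 * real (rcf_quot t (Suc n)))"
  using convergent_error_le[where X = "\<lambda>n. ((\<lambda>x. 1 / frac x) ^^ n) t" and e = "rcf_quot t",
      OF irrational_complete_quotients[OF assms], of n]
  by (simp add: rcf_num_eq rcf_den_eq)

section \<open>Reals with prescribed partial quotients as limits of finite continued
  fractions\<close>

fun cf_tail :: "(nat \<Rightarrow> nat) \<Rightarrow> nat \<Rightarrow> nat \<Rightarrow> real" where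
  "cf_tail e k 0 = e k"
| "cf_tail e k (Suc n) = e k + 1 / cf_tail e (Suc k) n"

lemma cf_tail_ge_1:
  assumes "\<And>i. e (Suc i) \<ge> 1"
  shows "cf_tail e (Suc k) n \<ge> 1"
proof (induction n arbitrary: k)
  case (Suc n)
  then have "1 / cf_tail e (Suc (Suc k)) n \<ge> 0" by (meson divide_nonneg_pos less_le_trans zero_le_one zero_less_one)
  moreover have "real (e (Suc k)) \<ge> 1" using assms[of k] by simp
  ultimately show ?case unfolding cf_tail.simps by linarith
qed (use assms in simp)

text \<open>Expanding two levels turns the difference into one of depth \<open>n\<close> starting
  two places later, divided by two products of consecutive tails. Each product has the form
  \<open>e * q + 1 \<ge> 2\<close>, so two levels gain a factor \<open>1 / 4\<close>.\<close>

lemma cf_tail_diff: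
  assumes e: "\<And>i. e (Suc i) \<ge> 1"
  shows "\<bar>cf_tail e k (Suc n) - cf_tail e k n\<bar> \<le> 2 * (1 / 2) ^ n"
proof (induction n arbitrary: k rule: induct_nat_012)
  case 0
  have "real (e (Suc k)) \<ge> 1" using e[of k] by simp
  then have "1 / real (e (Suc k)) \<le> 1" by (subst divide_le_eq_1_pos) auto
  then show ?case by simp
next
  case 1
  have 1: "real (e (Suc k)) \<ge> 1" using e[of k] by simp
  have 2: "cf_tail e (Suc k) (Suc 0) \<ge> 1" by (rule cf_tail_ge_1[where e = e, OF e])
  have "0 \<le> 1 / cf_tail e (Suc k) (Suc 0)" "1 / cf_tail e (Suc k) (Suc 0) \<le> 1"
    "0 \<le> 1 / cf_tail e (Suc k) 0" "1 / cf_tail e (Suc k) 0 \<le> 1"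
    using 1 2 by (simp_all del: cf_tail.simps(2))
  then have "\<bar>1 / cf_tail e (Suc k) (Suc 0) - 1 / cf_tail e (Suc k) 0\<bar> \<le> 1" by linarith
  then show ?case by (simp del: cf_tail.simps add: cf_tail.simps(2)[of e k])
next
  case (ge2 n)
  define p where "p = cf_tail e (Suc k)"
  define q where "q = cf_tail e (Suc (Suc k))"
  have p1: "p j \<ge> 1" for j unfolding p_def by (rule cf_tail_ge_1[where e = e, OF e])
  have q1: "q j \<ge> 1" for j unfolding q_def by (rule cf_tail_ge_1[where e = e, OF e])
  have pq: "p (Suc j) * q j \<ge> 2" for j
  proof -
    have "q j \<noteq> 0" using q1[of j] by linarith
    then have "p (Suc j) * q j = e (Suc k) * q j + 1" by (simp add: p_def q_def field_simps)
    moreover have "1 * 1 \<le> e (Suc k) * q j" using q1[of j] e[of k] by (intro mult_mono) auto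
    ultimately show ?thesis by linarith
  qed
  have nz: "p j \<noteq> 0" "q j \<noteq> 0" for j using p1[of j] q1[of j] by linarith+
  have "cf_tail e k (Suc (Suc (Suc n))) - cf_tail e k (Suc (Suc n)) = 1 / p (Suc (Suc n)) - 1 / p (Suc n)"
    by (simp add: p_def)
  also have "\<dots> = (p (Suc n) - p (Suc (Suc n))) / (p (Suc (Suc n)) * p (Suc n))"
    using nz by (simp add: field_simps)
  also have "p (Suc n) - p (Suc (Suc n)) = 1 / q n - 1 / q (Suc n)"
    by (simp add: p_def q_def)
  also have "\<dots> = (q (Suc n) - q n) / (q n * q (Suc n))"
    using nz by (simp add: field_simps)
  finally have "\<bar>cf_tail e k (Suc (Suc (Suc n))) - cf_tail e k (Suc (Suc n))\<bar> =
     \<bar>q (Suc n) - q n\<bar> / \<bar>(p (Suc (Suc n)) * q (Suc n)) * (p (Suc n) * q n)\<bar>"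
    by (simp add: abs_mult mult_ac)
  also have "\<dots> \<le> (2 * (1 / 2) ^ n) / (2 * 2)"
  proof (intro frac_le)
    show "\<bar>q (Suc n) - q n\<bar> \<le> 2 * (1 / 2) ^ n" unfolding q_def by (rule ge2.IH(1))
    have "2 * 2 \<le> (p (Suc (Suc n)) * q (Suc n)) * (p (Suc n) * q n)"
      using pq by (intro mult_mono) (auto intro: order_trans[OF _ pq])
    then show "2 * 2 \<le> \<bar>(p (Suc (Suc n)) * q (Suc n)) * (p (Suc n) * q n)\<bar>" by linarith
  qed auto
  finally show ?case by simp
qed

text \<open>The finite continued fractions starting at \<open>k\<close> converge by telescoping
  against a geometric series. Because \<open>cf_tail\<close> unfolds at the front, their limits
  inherit the recursion of complete quotients.\<close>

lemma exists_complete_quotients: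
  assumes e: "\<And>i. e (Suc i) \<ge> 1"
  shows "\<exists>X :: nat \<Rightarrow> real. (\<forall>n. X n = real (e n) + 1 / X (Suc n)) \<and> (\<forall>n. X (Suc n) > 1)"
proof -
  have conv: "convergent (cf_tail e k)" for k
  proof -
    have "summable (\<lambda>n. 2 * (1 / 2 :: real) ^ n)" by (intro summable_mult summable_geometric) simp
    then have "summable (\<lambda>n. cf_tail e k (Suc n) - cf_tail e k n)"
      by (rule summable_comparison_test') (use cf_tail_diff[where e = e, OF e] in auto)
    then have "convergent (\<lambda>n. \<Sum>i<n. cf_tail e k (Suc i) - cf_tail e k i)"
      by (simp add: summable_iff_convergent)
    then have "convergent (\<lambda>n. cf_tail e k n - cf_tail e k 0)"
      by (simp only: sum_lessThan_telescope)
    then show ?thesis using convergent_add[OF _ convergent_const[of "cf_tail e k 0"]] by fastforce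
  qed
  define X where "X k = lim (cf_tail e k)" for k
  have L: "cf_tail e k \<longlonglongrightarrow> X k" for k
    using conv[of k] by (simp add: X_def convergent_LIMSEQ_iff)
  have ge: "X (Suc k) \<ge> 1" for k
    by (rule LIMSEQ_le_const[OF L]) (use cf_tail_ge_1[where e = e, OF e] in auto)
  have rec: "X k = real (e k) + 1 / X (Suc k)" for k
  proof (rule LIMSEQ_unique)
    show "(\<lambda>n. cf_tail e k (Suc n)) \<longlonglongrightarrow> X k" using L by (rule LIMSEQ_Suc)
    have "X (Suc k) \<noteq> 0" using ge[of k] by linarith
    then show "(\<lambda>n. cf_tail e k (Suc n)) \<longlonglongrightarrow> real (e k) + 1 / X (Suc k)"
      unfolding cf_tail.simps by (intro tendsto_intros L)
  qed
  \<comment> \<open>The limit gives only a weak inequality; strictness comes from the recursion,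
    whose second summand is positive.\<close>
  have "X (Suc k) > 1" for k
  proof -
    have "1 / X (Suc (Suc k)) > 0" using ge[of "Suc k"] by simp
    then show ?thesis using rec[of "Suc k"] e[of k] by linarith
  qed
  with rec show ?thesis by blast
qed

section \<open>Prescribing residues of convergents modulo \<open>d\<close>\<close>

text \<open>\<open>cf_vec es\<close> is the first column of the product of the matrices \<open>((e, 1), (1, 0))\<close> over
  the entries \<open>e\<close> of \<open>es\<close>.\<close>

fun cf_vec :: "nat list \<Rightarrow> int \<times> int" where
  "cf_vec [] = (1, 0)"
| "cf_vec (e # es) = (int e * fst (cf_vec es) + snd (cf_vec es), fst (cf_vec es))"

lemma cnum_append:
  assumes "\<And>i. i < length es \<Longrightarrow> e (Suc m + i) = es ! i"
  shows "int (cnum e (Suc m + length es)) =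
    int (cnum e (Suc m)) * fst (cf_vec es) + int (cnum e m) * snd (cf_vec es)"
  using assms
proof (induction es arbitrary: m)
  case (Cons a es)
  have "e (Suc m) = a" using Cons.prems[of 0] by simp
  moreover have "e (Suc (Suc m) + i) = es ! i" if "i < length es" for i
    using Cons.prems[of "Suc i"] that by simp
  ultimately show ?case using Cons.IH[of "Suc m"] by (simp add: algebra_simps)
qed simp

lemma cden_append:
  assumes "\<And>i. i < length es \<Longrightarrow> e (Suc m + i) = es ! i"
  shows "int (cden e (Suc m + length es)) =
    int (cden e (Suc m)) * fst (cf_vec es) + int (cden e m) * snd (cf_vec es)"
  using assms
proof (induction es arbitrary: m)
  case (Cons a es)
  have "e (Suc m) = a" using Cons.prems[of 0] by simp
  moreover have "e (Suc (Suc m) + i) = es ! i" if "i < length es" for i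
    using Cons.prems[of "Suc i"] that by simp
  ultimately show ?case using Cons.IH[of "Suc m"] by (simp add: algebra_simps)
qed simp

text \<open>The Euclidean algorithm, with quotients made positive by adding multiples of \<open>d\<close>. It ends
  at \<open>(\<plusminus>1, 0)\<close>; the sign is removed by the quotients \<open>d, 1, 2 d - 1\<close>.\<close>

lemma cf_vec_surj_mod:
  fixes x y :: int and d :: nat
  assumes d: "d \<ge> 1" and "coprime x y"
  shows "\<exists>es. (\<forall>e\<in>set es. e \<ge> 1) \<and> [fst (cf_vec es) = x] (mod int d) \<and>
    [snd (cf_vec es) = y] (mod int d)"
  using assms(2)
proof (induction "nat \<bar>y\<bar>" arbitrary: x y rule: less_induct)
  case less
  show ?case
  proof (cases "y = 0")
    case True
    with less.prems have "x = 1 \<or> x = - 1" by auto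
    then show ?thesis
    proof
      assume "x = 1"
      with True show ?thesis by (intro exI[of _ "[]"]) simp
    next
      assume x: "x = - 1"
      obtain n where n: "int n = 2 * int d - 1" "n \<ge> 1"
        using d by (intro that[of "2 * d - 1"]) (simp_all add: of_nat_diff)
      then have "fst (cf_vec [d, 1, n]) = - 1 + int d * (2 * int d + 2)"
        "snd (cf_vec [d, 1, n]) = 0 + int d * 2"
        by (simp_all add: algebra_simps)
      then have "[fst (cf_vec [d, 1, n]) = - 1] (mod int d)" "[snd (cf_vec [d, 1, n]) = 0] (mod int d)"
        by (simp_all only: cong_def mod_mult_self2)
      then show ?thesis using True x d n by (intro exI[of _ "[d, 1, n]"]) simp
    qed
  next
    case False
    have "coprime y (x mod y)" using less.prems False
      by (metis coprime_commute coprime_mod_left_iff)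
    moreover have "nat \<bar>x mod y\<bar> < nat \<bar>y\<bar>" using False
      by (simp add: abs_mod_less)
    ultimately obtain es where es: "\<forall>e\<in>set es. e \<ge> 1"
      "[fst (cf_vec es) = y] (mod int d)" "[snd (cf_vec es) = x mod y] (mod int d)"
      using less.hyps by blast
    define a where "a = nat ((x div y) mod int d + int d)"
    have a: "int a = (x div y) mod int d + int d" and a1: "a \<ge> 1"
      using d pos_mod_sign[of "int d" "x div y"] unfolding a_def by linarith+
    have "[int a = x div y] (mod int d)" by (simp add: a cong_def)
    then have "[int a * fst (cf_vec es) + snd (cf_vec es) = x div y * y + x mod y] (mod int d)"
      using es by (intro cong_add cong_mult)
    then show ?thesis using es a1 by (intro exI[of _ "a # es"]) simp
  qed
qed

text \<open>One step of the diagonal construction. Appending a block acts on numerators and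
  denominators through the same vector \<open>cf_vec es\<close>, so the target \<open>(x, y)\<close>
  is pulled back through the unimodular matrix of the last two convergents and then realised by
  \<open>cf_vec_surj_mod\<close>. The quotient after the block is still free and is chosen
  large.\<close>

lemma extend_quotients:
  fixes x y :: int and d m :: nat and \<beta> :: "nat \<Rightarrow> nat" and avoid :: "nat \<Rightarrow> nat"
  assumes d: "d \<ge> 1" and co: "coprime x y" and e: "e 0 = 0" "\<And>i. e (Suc i) \<ge> 1"
  shows "\<exists>e' h. e' 0 = 0 \<and> (\<forall>i. e' (Suc i) \<ge> 1) \<and> m \<le> h \<and> (\<forall>i\<le>m. e' i = e i) \<and>
     [int (cnum e' (Suc h)) = x] (mod int d) \<and> [int (cden e' (Suc h)) = y] (mod int d) \<and>
     e' (Suc h) > \<beta> (cden e' (Suc h)) \<and> e' (Suc h) > avoid (Suc h)"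
proof -
  define A B C D where "A = int (cnum e (Suc m))" "B = int (cnum e m)"
    "C = int (cden e (Suc m))" "D = int (cden e m)"
  note defs = this
  define \<Delta> where "\<Delta> = A * D - B * C"
  have "\<Delta> = 1 \<or> \<Delta> = - 1"
    unfolding \<Delta>_def defs cnum_cden_det by (cases "even m") auto
  then have \<Delta>: "\<Delta> * \<Delta> = 1" by auto
  \<comment> \<open>The inverse matrix applied to \<open>(x, y)\<close>; its determinant factor is
    \<open>\<Delta>\<close> itself, since \<open>\<Delta> * \<Delta> = 1\<close>. Integrality in
    both directions transfers coprimality to \<open>(p, q)\<close>.\<close>
  define p q where "p = \<Delta> * (x * D - y * B)" "q = \<Delta> * (y * A - x * C)"
  note pq = this
  have "A * p + B * q = (\<Delta> * \<Delta>) * x" "C * p + D * q = (\<Delta> * \<Delta>) * y"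
    unfolding pq \<Delta>_def by (simp_all add: algebra_simps)
  then have x: "A * p + B * q = x" and y: "C * p + D * q = y" by (simp_all add: \<Delta>)
  have "coprime p q"
  proof (rule coprimeI)
    fix c assume "c dvd p" "c dvd q"
    then have "c dvd x" "c dvd y" unfolding x[symmetric] y[symmetric] by simp_all
    with co show "is_unit c" by (meson coprime_common_divisor)
  qed
  with d obtain es where es: "\<forall>e\<in>set es. e \<ge> 1"
      "[fst (cf_vec es) = p] (mod int d)" "[snd (cf_vec es) = q] (mod int d)"
    using cf_vec_surj_mod by blast
  define h where "h = m + length es"
  define e1 where "e1 = (\<lambda>i. if i \<le> m then e i else if i \<le> h then es ! (i - Suc m) else 1)"
  \<comment> \<open>Changing entry \<open>Suc h\<close> leaves \<open>cden e1 (Suc h)\<close>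
    unchanged, so \<open>E\<close> may depend on this denominator without circularity.\<close>
  define E where "E = Suc (\<beta> (cden e1 (Suc h)) + avoid (Suc h))"
  define e' where "e' = e1 (Suc h := E)"
  have e1m: "cnum e1 (Suc m) = cnum e (Suc m)" "cnum e1 m = cnum e m"
     "cden e1 (Suc m) = cden e (Suc m)" "cden e1 m = cden e m"
    by (rule cnum_cong cden_cong, simp add: e1_def)+
  have e1h: "cnum e' (Suc h) = cnum e1 (Suc h)" "cden e' (Suc h) = cden e1 (Suc h)"
    by (rule cnum_cong cden_cong, simp add: e'_def)+
  have nth: "e1 (Suc m + i) = es ! i" if "i < length es" for i
    using that by (simp add: e1_def h_def)
  have "int (cnum e' (Suc h)) = A * fst (cf_vec es) + B * snd (cf_vec es)"
    using cnum_append[of es e1 m] nth by 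
      (simp only: e1h[unfolded h_def] e1m defs h_def add_Suc)
  moreover have "[A * fst (cf_vec es) + B * snd (cf_vec es) = A * p + B * q] (mod int d)"
    by (intro cong_add cong_mult cong_refl es)
  ultimately have 1: "[int (cnum e' (Suc h)) = x] (mod int d)" by (simp only: x)
  have "int (cden e' (Suc h)) = C * fst (cf_vec es) + D * snd (cf_vec es)"
    using cden_append[of es e1 m] nth by 
      (simp only: e1h[unfolded h_def] e1m defs h_def add_Suc)
  moreover have "[C * fst (cf_vec es) + D * snd (cf_vec es) = C * p + D * q] (mod int d)"
    by (intro cong_add cong_mult cong_refl es)
  ultimately have 2: "[int (cden e' (Suc h)) = y] (mod int d)" by (simp only: y)
  have 3: "e' 0 = 0" using e by (simp add: e'_def e1_def)
  have "e1 (Suc i) \<ge> 1" for i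
    using e(2)[of i] es(1) nth_mem[of "i - m" es] by (auto simp: e1_def h_def)
  then have 4: "e' (Suc i) \<ge> 1" for i by (simp add: e'_def E_def)
  have 5: "e' (Suc h) > \<beta> (cden e' (Suc h)) \<and> e' (Suc h) > avoid (Suc h)"
    unfolding e1h by (simp add: e'_def E_def)
  have 6: "e' i = e i" if "i \<le> m" for i using that by (simp add: e'_def e1_def h_def)
  show ?thesis
    using 1 2 3 4 5 6 by (intro exI[of _ e'] exI[of _ h]) (auto simp: h_def)
qed

section \<open>Size of the exceptional set\<close>

lemma unit_exp_eq_cis: "unit_exp \<tau> = cis (2 * pi * \<tau>)"
  by (simp add: unit_exp_def cis_conv_exp mult_ac)

lemma inj_on_unit_exp: "inj_on unit_exp {0..<1}"
proof (rule inj_onI)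
  fix x y :: real assume xy: "x \<in> {0..<1}" "y \<in> {0..<1}" "unit_exp x = unit_exp y"
  have "Arg2pi (unit_exp t) = 2 * pi * t" if "t \<in> {0..<1}" for t
    using that by (intro Arg2pi_unique[of 1]) (auto simp: unit_exp_eq_cis cis_conv_exp)
  then show "x = y" using xy by (metis mult_left_cancel pi_neq_zero mult_eq_0_iff zero_neq_numeral)
qed

text \<open>The closed parameter interval makes the arc compact and therefore Borel. The radius is
  \<open>2 * pi\<close> times an approximation error of \<open>1 / m ^ 4\<close>.\<close>

definition near_arc :: "nat \<Rightarrow> nat \<Rightarrow> complex set" where
  "near_arc m c = cis ` ({0..2 * pi} \<inter> cball (2 * pi * (real c / real m)) (2 * pi / real m ^ 4))"

text \<open>Since \<open>cis\<close> is injective on the half-open interval, the preimage of the arc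
  lies in the defining interval of length \<open>4 * pi / m ^ 4\<close>, up to the point 0, which
  arises from the parameter \<open>2 * pi\<close> and has measure zero.\<close>

lemma emeasure_near_arc_le:
  defines "M \<equiv> distr (restrict_space lborel {0..<2 * pi}) (restrict_space borel (sphere 0 1)) cis"
  shows "near_arc m c \<in> sets M" "emeasure M (near_arc m c) \<le> ennreal (4 * pi / real m ^ 4)"
proof -
  let ?J = "cball (2 * pi * (c / m)) (2 * pi / real m ^ 4)"
  have "compact (near_arc m c)"
    unfolding near_arc_def by (intro compact_continuous_image continuous_intros closed_Int_compact) auto
  then have "near_arc m c \<in> sets borel" by (intro borel_compact)
  moreover have "near_arc m c \<subseteq> sphere 0 1" by (auto simp: near_arc_def)
  ultimately have arc: "near_arc m c \<in> sets (restrict_space borel (sphere 0 1))"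
    by (simp add: sets_restrict_space_iff)
  then show "near_arc m c \<in> sets M" by (simp add: M_def)
  let ?V = "cis -` near_arc m c \<inter> space (restrict_space lborel {0..<2 * pi})"
  have V: "?V \<in> sets (restrict_space lborel {0..<2 * pi})"
    using measurable_sets[OF measurable_cis_circle arc] .
  have "?V \<subseteq> insert 0 ?J"
  proof
    fix \<theta> assume "\<theta> \<in> ?V"
    then have \<theta>: "0 \<le> \<theta>" "\<theta> < 2 * pi" "cis \<theta> \<in> near_arc m c" by (auto simp: space_restrict_space)
    then obtain \<phi> where \<phi>: "0 \<le> \<phi>" "\<phi> \<le> 2 * pi" "\<phi> \<in> ?J" "cis \<theta> = cis \<phi>" by (auto simp: near_arc_def)
    have A: "Arg2pi (cis x) = x" if "0 \<le> x" "x < 2 * pi" for x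
      using that by (intro Arg2pi_unique[of 1]) (auto simp: cis_conv_exp)
    show "\<theta> \<in> insert 0 ?J"
    proof (cases "\<phi> = 2 * pi")
      case True
      then have "cis \<theta> = cis 0" using \<phi> by simp
      then have "Arg2pi (cis \<theta>) = Arg2pi (cis 0)" by (rule arg_cong)
      then show ?thesis using A[OF \<theta>(1,2)] A[of 0] pi_gt_zero by simp
    next
      case False
      then have "\<phi> < 2 * pi" using \<phi>(2) by linarith
      then have "\<theta> = \<phi>" using A[OF \<theta>(1,2)] A[OF \<phi>(1)] \<phi>(4) by metis
      then show ?thesis using \<phi>(3) by blast
    qed
  qed
  have "emeasure M (near_arc m c) = emeasure (restrict_space lborel {0..<2 * pi}) ?V"
    unfolding M_def by (rule emeasure_distr[OF measurable_cis_circle arc])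
  also have "\<dots> = emeasure lborel ?V"
    by (intro emeasure_restrict_space) (auto simp: space_restrict_space)
  also have "\<dots> \<le> emeasure lborel (insert 0 ?J)"
    by (intro emeasure_mono \<open>?V \<subseteq> insert 0 ?J\<close>) auto
  also have "\<dots> \<le> emeasure lborel {0::real} + emeasure lborel ?J"
    using emeasure_subadditive[of "{0::real}" lborel ?J] by simp
  also have "\<dots> = ennreal (4 * pi / real m ^ 4)"
    by (simp add: cball_eq_atLeastAtMost)
  finally show "emeasure M (near_arc m c) \<le> ennreal (4 * pi / real m ^ 4)" .
qed

text \<open>Borel--Cantelli: there are \<open>m + 1\<close> arcs of length \<open>4 \<pi> / m\<^sup>4\<close> for each denominator \<open>m\<close>.\<close>

lemma well_approximable_null:
  assumes "S \<subseteq> {0..<1}"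
    and S: "\<And>t n. t \<in> S \<Longrightarrow> \<exists>m\<ge>n. \<exists>c\<le>m. \<bar>t - real c / real m\<bar> \<le> 1 / real m ^ 4"
  shows "unit_exp ` S \<in> null_sets circle_measure"
proof -
  define M where "M = distr (restrict_space lborel {0..<2 * pi}) (restrict_space borel (sphere 0 1)) cis"
  define U where "U m = (\<Union>c\<le>m. near_arc m c)" for m
  have Um: "U m \<in> sets M" for m
    unfolding U_def M_def by (intro sets.finite_UN emeasure_near_arc_le) auto
  have Ule: "emeasure M (U m) \<le> ennreal (8 * pi * (1 / real m ^ 2))" for m
  \<comment> \<open>Division by 0 gives 0, so for \<open>m = 0\<close> the arc has radius 0 and both
    sides vanish.\<close>
  proof (cases "m = 0")
    case True
    then have "U m = near_arc 0 0" by (simp add: U_def)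
    then show ?thesis using True emeasure_near_arc_le(2)[of 0 0] by (simp add: M_def)
  next
    case False
    have "emeasure M (U m) \<le> (\<Sum>c\<le>m. emeasure M (near_arc m c))"
      unfolding U_def M_def by (intro emeasure_subadditive_finite) (auto simp del: sets_distr intro: emeasure_near_arc_le)
    also have "\<dots> \<le> (\<Sum>c\<le>m. ennreal (4 * pi / real m ^ 4))"
      unfolding M_def by (intro sum_mono emeasure_near_arc_le)
    also have "\<dots> = ennreal (\<Sum>c\<le>m. 4 * pi / real m ^ 4)" by (intro sum_ennreal) simp
    also have "\<dots> \<le> ennreal (8 * pi * (1 / real m ^ 2))"
    proof (rule ennreal_leI)
      have m: "real m \<ge> 1" using False by simp
      have "(\<Sum>c\<le>m. 4 * pi / real m ^ 4) = (real m + 1) * (4 * pi / real m ^ 4)" by simp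
      also have "\<dots> \<le> (2 * real m ^ 2) * (4 * pi / real m ^ 4)"
      proof (intro mult_right_mono)
        have "real m * 1 \<le> real m * real m" using m by (intro mult_left_mono) auto
        then show "real m + 1 \<le> 2 * real m ^ 2" using m unfolding power2_eq_square by linarith
      qed simp
      also have "\<dots> = 8 * pi * (1 / real m ^ 2)" using m by (simp add: field_simps flip: power_add)
      finally show "(\<Sum>c\<le>m. 4 * pi / real m ^ 4) \<le> 8 * pi * (1 / real m ^ 2)" .
    qed
    finally show ?thesis .
  qed
  have fin: "emeasure M (U m) < \<infinity>" for m
    using Ule[of m] by (simp add: le_less_trans)
  have "summable (\<lambda>m. 8 * pi * (1 / real m ^ 2))"
    using inverse_power_summable[of 2, where ?'a = real] by (intro summable_mult) (simp add: inverse_eq_divide)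
  then have "summable (\<lambda>m. measure M (U m))"
  proof (rule summable_comparison_test'[where N = 0])
    fix m
    show "norm (measure M (U m)) \<le> 8 * pi * (1 / real m ^ 2)"
      using Ule[of m] fin[of m] by (simp add: emeasure_eq_ennreal_measure less_top)
  qed
  then have "limsup U \<in> null_sets M"
    by (rule borel_cantelli_limsup1[OF Um fin])
  moreover have "unit_exp ` S \<subseteq> limsup U"
  proof
    fix z assume "z \<in> unit_exp ` S"
    then obtain t where t: "t \<in> S" "z = cis (2 * pi * t)" by (auto simp: unit_exp_eq_cis)
    then have t01: "0 \<le> t" "t < 1" using assms(1) by auto
    have "\<exists>m\<ge>n. z \<in> U m" for n
    proof -
      obtain m c where m: "m \<ge> n" "c \<le> m" "\<bar>t - real c / real m\<bar> \<le> 1 / real m ^ 4"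
        using S[OF t(1)] by blast
      have "2 * pi * \<bar>t - real c / real m\<bar> \<le> 2 * pi * (1 / real m ^ 4)"
        using m by (intro mult_left_mono) auto
      moreover have "\<bar>2 * pi * (real c / real m) - 2 * pi * t\<bar> = 2 * pi * \<bar>t - real c / real m\<bar>"
      proof -
        have "2 * pi * (real c / real m) - 2 * pi * t = (2 * pi) * (real c / real m - t)"
          by (simp add: right_diff_distrib)
        then show ?thesis by (simp only: abs_mult abs_minus_commute[of t]) simp
      qed
      ultimately have "2 * pi * t \<in> cball (2 * pi * (real c / real m)) (2 * pi / real m ^ 4)"
        by (simp add: dist_real_def)
      then have "z \<in> near_arc m c" unfolding near_arc_def t(2) using t01 by (intro imageI) auto
      with m show ?thesis by (auto simp: U_def)
    qed
    then show "z \<in> limsup U" by (auto simp: limsup_INF_SUP)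
  qed
  \<comment> \<open>In the completion every subset of a null set is null, which settles the image of
    \<open>S\<close> without a measurability argument.\<close>
  ultimately show ?thesis
    unfolding circle_measure_def M_def[symmetric] by (auto intro: null_sets_completion_subset null_sets_completionI)
qed

text \<open>From an enumeration \<open>T\<close> of the set, quotients are built in stages. Stage
  \<open>n\<close> reaches the residue class of \<open>r\<close> or \<open>u\<close> according to
  the parity of \<open>n\<close>, then takes a quotient above the threshold and above the
  corresponding quotient of \<open>T n\<close>. The resulting number belongs to the set but differs
  from every \<open>T n\<close>.\<close>

lemma S_diamond_uncountable:
  assumes d: "d \<ge> 1" and co: "coprime r s" "coprime u s"
  shows "uncountable (S_diamond k d s r u N' \<gamma>)"
proof
  define S where "S = S_diamond k d s r u N' \<gamma>"
  assume "countable (S_diamond k d s r u N' \<gamma>)"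
  then have cS: "countable S" by (simp add: S_def)
  define T where "T = from_nat_into S"
  define \<beta> where "\<beta> = (\<lambda>D. nat \<lceil>2 * pi * real (\<gamma> (k * N' * D\<^sup>2))\<rceil>)"
  define x where "x = (\<lambda>n :: nat. if even n then r else u)"
  have cox: "coprime (int (x n)) (int s)" for n using co by (simp add: x_def)
  define P where "P = (\<lambda>(e :: nat \<Rightarrow> nat, m :: nat). e 0 = 0 \<and> (\<forall>i. e (Suc i) \<ge> 1))"
  \<comment> \<open>In a state \<open>(e, m)\<close> the entries of \<open>e\<close> up to
    \<open>m\<close> are final. Setting \<open>m' = Suc h\<close> freezes the large quotient
    together with the block before it.\<close>
  define Q where "Q = (\<lambda>(n :: nat) (e :: nat \<Rightarrow> nat, m) (e', m'). \<exists>h. m' = Suc h \<and> m \<le> h \<and> (\<forall>i\<le>m. e' i = e i) \<and>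
    [int (cnum e' (Suc h)) = int (x n)] (mod int d) \<and> [int (cden e' (Suc h)) = int s] (mod int d) \<and>
    e' (Suc h) > \<beta> (cden e' (Suc h)) \<and> e' (Suc h) > rcf_quot (T n) (Suc h))"
  have "\<exists>F. \<forall>n. P (F n) \<and> Q n (F n) (F (Suc n))"
  proof (rule dependent_nat_choice)
    show "\<exists>z. P z" by (intro exI[of _ "(\<lambda>i. if i = 0 then 0 else 1, 0)"]) (simp add: P_def)
    fix z n assume "P z"
    obtain e m where z: "z = (e, m)" by (cases z)
    with \<open>P z\<close> have e: "e 0 = 0" "\<And>i. e (Suc i) \<ge> 1" by (auto simp: P_def)
    obtain e' h where "e' 0 = 0 \<and> (\<forall>i. e' (Suc i) \<ge> 1) \<and> m \<le> h \<and> (\<forall>i\<le>m. e' i = e i) \<and>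
      [int (cnum e' (Suc h)) = int (x n)] (mod int d) \<and> [int (cden e' (Suc h)) = int s] (mod int d) \<and>
      e' (Suc h) > \<beta> (cden e' (Suc h)) \<and> e' (Suc h) > rcf_quot (T n) (Suc h)"
      using extend_quotients[where e = e and m = m and \<beta> = \<beta> and avoid = "rcf_quot (T n)", OF d cox[of n] e]
      by metis
    then show "\<exists>z'. P z' \<and> Q n z z'"
      unfolding P_def Q_def z by (intro exI[of _ "(e', Suc h)"]) simp
  qed
  then obtain F where F: "\<And>n. P (F n)" "\<And>n. Q n (F n) (F (Suc n))" by blast
  define E where "E n = fst (F n)" for n
  define m where "m n = snd (F n)" for n
  have E0: "E n 0 = 0" and E1: "E n (Suc i) \<ge> 1" for n i
    using F(1)[of n] by (auto simp: P_def E_def split: prod.splits)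
  define h where "h n = m (Suc n) - 1" for n
  have step: "m (Suc n) = Suc (h n)" "m n \<le> h n" "\<forall>i\<le>m n. E (Suc n) i = E n i"
    "[int (cnum (E (Suc n)) (Suc (h n))) = int (x n)] (mod int d)"
    "[int (cden (E (Suc n)) (Suc (h n))) = int s] (mod int d)"
    "E (Suc n) (Suc (h n)) > \<beta> (cden (E (Suc n)) (Suc (h n)))"
    "E (Suc n) (Suc (h n)) > rcf_quot (T n) (Suc (h n))" for n
    using F(2)[of n] by (auto simp: Q_def E_def m_def h_def split: prod.splits)
  have msm: "strict_mono m" by (rule strict_monoI_Suc) (use step(1,2) in \<open>simp add: le_imp_less_Suc\<close>)
  have hsm: "strict_mono h"
    by (rule strict_monoI_Suc) (metis step(1,2) Suc_le_eq)
  have mono: "E n' i = E n i" if "n \<le> n'" "i \<le> m n" for n n' i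
    using that(1)
  proof (induction n' rule: dec_induct)
    case (step n')
    have "m n \<le> m n'" using msm step.hyps by (simp add: strict_mono_less_eq)
    then show ?case using step that \<open>\<And>n. \<forall>i\<le>m n. E (Suc n) i = E n i\<close> by simp
  qed simp
  \<comment> \<open>Entry \<open>i\<close> is final at stage \<open>i\<close>, because
    \<open>m\<close> is strictly increasing and so \<open>i \<le> m i\<close>.\<close>
  define e where "e i = E i i" for i
  have ee: "e i = E n i" if "i \<le> m n" for n i
  proof (cases "n \<le> i")
    case True
    then show ?thesis unfolding e_def using mono[of n i i] that by simp
  next
    case False
    have "i \<le> m i" using msm by (rule strict_mono_imp_increasing)
    then show ?thesis unfolding e_def using mono[of i n i] False by simp
  qed
  have e0: "e 0 = 0" and e1: "e (Suc i) \<ge> 1" for i using E0 E1 by (simp_all add: e_def)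
  obtain X where X: "\<And>n. X n = real (e n) + 1 / X (Suc n)" "\<And>n. X (Suc n) > 1"
    using exists_complete_quotients[where e = e, OF e1] by blast
  define t where "t = X 0"
  have quot: "rcf_quot t = e" unfolding t_def by (rule rcf_quot_of_complete_quotients[where X = X and e = e, OF X])
  have t: "0 < t" "t < 1" "t \<notin> \<rat>"
  proof -
    have "t = 1 / X 1" using X(1)[of 0] e0 by (simp add: t_def)
    then show "0 < t" "t < 1" using X(2)[of 0] by simp_all
    show "t \<notin> \<rat>" unfolding t_def by (rule irrational_of_complete_quotients[where X = X and e = e, OF X e1])
  qed
  have eh: "e (Suc (h n)) = E (Suc n) (Suc (h n))" for n
    using ee[of "Suc (h n)" "Suc n"] step(1)[of n] by simp
  have num: "rcf_num t (h n) = cnum (E (Suc n)) (Suc (h n))" for n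
    unfolding rcf_num_eq quot by (rule cnum_cong, rule ee) (simp add: step(1))
  have den: "rcf_den t (h n) = cden (E (Suc n)) (Suc (h n))" for n
    unfolding rcf_den_eq quot by (rule cden_cong, rule ee) (simp add: step(1))
  have cong: "[rcf_num t (h n) = x n] (mod d)" "[rcf_den t (h n) = s] (mod d)" for n
    using step(4,5)[of n] unfolding num den cong_int_iff .
  have big: "real (rcf_quot t (h n + 1)) > 2 * pi * real (\<gamma> (k * N' * (rcf_den t (h n))\<^sup>2))" for n
  proof -
    have "rcf_quot t (h n + 1) > \<beta> (rcf_den t (h n))"
      using step(6)[of n] by (simp add: quot eh den)
    then show ?thesis unfolding \<beta>_def by linarith
  qed
  have "t \<in> S"
    unfolding S_def S_diamond_def
  proof (intro CollectI conjI t exI allI ballI)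
    show "strict_mono (\<lambda>n. h (2 * n))" "strict_mono (\<lambda>n. h (2 * n + 1))"
      using hsm by (auto simp: strict_mono_def)
    show "[rcf_num t (h (2 * n)) = r] (mod d)" "[rcf_num t (h (2 * n + 1)) = u] (mod d)" for n
      using cong(1)[of "2 * n"] cong(1)[of "2 * n + 1"] by (simp_all add: x_def)
    show "[rcf_den t (h (2 * n)) = s] (mod d)" "[rcf_den t (h (2 * n + 1)) = s] (mod d)" for n
      using cong(2) by blast+
  qed (use big in auto)
  then obtain n where "T n = t" unfolding T_def using cS by (metis from_nat_into_surj)
  then show False using step(7)[of n] by (simp add: quot eh)
qed

section \<open>Limits of generally convergent continued fractions\<close>

text \<open>Inverse stereographic projection onto the unit sphere. Chords there are twice the
  chordal distance, so chordal limits become ordinary limits in a metric space.\<close>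

fun stereo :: "ext_complex \<Rightarrow> complex \<times> real" where
  "stereo (Fin z) =
     (2 * z / of_real (1 + (cmod z)\<^sup>2), ((cmod z)\<^sup>2 - 1) / (1 + (cmod z)\<^sup>2))"
| "stereo Infty = (0, 1)"

lemma dist_stereo_Fin_Infty: "dist (stereo (Fin z)) (stereo Infty) = 2 / sqrt (1 + (cmod z)\<^sup>2)"
proof -
  define n where "n = (cmod z)\<^sup>2"
  have n: "n \<ge> 0" by (simp add: n_def)
  have "(dist (stereo (Fin z)) (stereo Infty))\<^sup>2 = (2 * cmod z / (1 + n))\<^sup>2 + ((n - 1) / (1 + n) - 1)\<^sup>2"
    using n unfolding dist_prod_def dist_norm stereo.simps n_def[symmetric]
    by (simp add: norm_divide norm_mult power2_commute[of "(n - 1) / (1 + n)"] del: of_real_add)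
  also have "(n - 1) / (1 + n) - 1 = - 2 / (1 + n)" using n by (simp add: field_simps)
  also have "(2 * cmod z / (1 + n))\<^sup>2 + (- 2 / (1 + n))\<^sup>2 = (4 * n + 4) / (1 + n)\<^sup>2"
    by (simp add: power_divide power_mult_distrib n_def add_divide_distrib)
  also have "\<dots> = (2 / sqrt (1 + n))\<^sup>2"
    using n by (simp add: power_divide divide_simps) (simp add: power2_eq_square algebra_simps)
  finally show ?thesis using n by (simp add: n_def)
qed

lemma dist_stereo_Fin_Fin:
  "dist (stereo (Fin w)) (stereo (Fin z)) =
    2 * (cmod (z - w) / (sqrt (1 + (cmod w)\<^sup>2) * sqrt (1 + (cmod z)\<^sup>2)))"
proof -
  define m n where "m = (cmod w)\<^sup>2" "n = (cmod z)\<^sup>2"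
  note mn = this
  define c where "c = Re w * Re z + Im w * Im z"
  have ge: "m \<ge> 0" "n \<ge> 0" by (simp_all add: mn)
  \<comment> \<open>Using reciprocals, with \<open>a * m = 1 - a\<close> and
    \<open>b * n = 1 - b\<close>, keeps the computation polynomial; \<open>c\<close> is the real
    inner product of \<open>w\<close> and \<open>z\<close>.\<close>
  define a b where "a = inverse (1 + m)" "b = inverse (1 + n)"
  have ab: "a * (1 + m) = 1" "b * (1 + n) = 1" using ge by (simp_all add: a_b_def)
  have "(cmod (2 * w / of_real (1 + m) - 2 * z / of_real (1 + n)))\<^sup>2 =
     (cmod (of_real (2 * a) * w - of_real (2 * b) * z))\<^sup>2"
    by (simp add: a_b_def divide_inverse mult_ac)
  also have "\<dots> = (2 * a * Re w - 2 * b * Re z)\<^sup>2 + (2 * a * Im w - 2 * b * Im z)\<^sup>2"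
    by (simp add: cmod_power2)
  also have "\<dots> = 4 * a\<^sup>2 * m - 8 * a * b * c + 4 * b\<^sup>2 * n"
    unfolding mn c_def cmod_power2 by (simp add: power2_eq_square algebra_simps)
  finally have 1: "(cmod (2 * w / of_real (1 + m) - 2 * z / of_real (1 + n)))\<^sup>2 =
    4 * a\<^sup>2 * m - 8 * a * b * c + 4 * b\<^sup>2 * n" .
  have am: "a * m = 1 - a" "b * n = 1 - b" using ab by (simp_all add: algebra_simps)
  have 2: "(m - 1) / (1 + m) - (n - 1) / (1 + n) = 2 * b - 2 * a"
    using am by (simp add: divide_inverse a_b_def[symmetric] algebra_simps)
  have 3: "(cmod (z - w))\<^sup>2 = m + n - 2 * c"
    unfolding mn c_def cmod_power2 by (simp add: power2_eq_square algebra_simps)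
  have "(dist (stereo (Fin w)) (stereo (Fin z)))\<^sup>2 =
     (cmod (2 * w / of_real (1 + m) - 2 * z / of_real (1 + n)))\<^sup>2 +
     ((m - 1) / (1 + m) - (n - 1) / (1 + n))\<^sup>2"
    unfolding dist_prod_def dist_norm stereo.simps mn[symmetric] by (simp del: of_real_add)
  also have "\<dots> = (4 * a\<^sup>2 * m - 8 * a * b * c + 4 * b\<^sup>2 * n) + (2 * b - 2 * a)\<^sup>2"
    unfolding 1 2 ..
  also have "\<dots> = 4 * a * (a * m) - 8 * a * b * c + 4 * b * (b * n) + (2 * b - 2 * a)\<^sup>2"
    by (simp add: power2_eq_square)
  also have "\<dots> = 4 * (a * (1 - b) + b * (1 - a) - 2 * a * b * c)"
    unfolding am by (simp add: power2_eq_square algebra_simps)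
  also have "\<dots> = 4 * (a * b * (m + n - 2 * c))"
    unfolding am[symmetric] by (simp add: algebra_simps)
  also have "\<dots> = (2 * (cmod (z - w) / (sqrt (1 + m) * sqrt (1 + n))))\<^sup>2"
    using ge by (simp add: power_mult_distrib power_divide 3 a_b_def field_simps)
  finally show ?thesis using ge by (simp add: mn)
qed

lemma dist_stereo: "dist (stereo p) (stereo q) = 2 * chordal p q"
proof (cases p; cases q)
  fix z assume "p = Infty" "q = Fin z"
  then show ?thesis using dist_stereo_Fin_Infty[of z] by (simp add: dist_commute del: stereo.simps)
next
  fix z assume "p = Fin z" "q = Infty"
  then show ?thesis using dist_stereo_Fin_Infty[of z] by (simp del: stereo.simps)
qed (simp_all add: dist_stereo_Fin_Infty dist_stereo_Fin_Fin del: stereo.simps(1))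

lemma chordal_nonneg: "chordal p q \<ge> 0"
  using zero_le_dist[of "stereo p" "stereo q"] unfolding dist_stereo by simp

lemma stereo_inj: "stereo p = stereo q \<Longrightarrow> p = q"
proof -
  assume "stereo p = stereo q"
  then have "chordal p q = 0" using dist_stereo[of p q] by simp
  moreover have "1 + x\<^sup>2 \<noteq> 0" for x :: real by (metis power_one sum_power2_eq_zero_iff zero_neq_one)
  ultimately show "p = q" by (cases p; cases q) auto
qed

lemma tendsto_stereo_iff:
  "(\<lambda>n. chordal (p n) l) \<longlonglongrightarrow> 0 \<longleftrightarrow> (\<lambda>n. stereo (p n)) \<longlonglongrightarrow> stereo l"
proof -
  have "(\<lambda>n. stereo (p n)) \<longlonglongrightarrow> stereo l \<longleftrightarrow> (\<lambda>n. 2 * chordal (p n) l) \<longlonglongrightarrow> 0"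
    by (subst tendsto_dist_iff) (simp add: dist_stereo)
  also have "\<dots> \<longleftrightarrow> (\<lambda>n. chordal (p n) l) \<longlonglongrightarrow> 0"
    using tendsto_mult_left_iff[of 2 "\<lambda>n. chordal (p n) l" 0 sequentially] by simp
  finally show ?thesis by simp
qed

lemma tendsto_stereo_Fin:
  assumes "z \<longlonglongrightarrow> l"
  shows "(\<lambda>n. stereo (Fin (z n))) \<longlonglongrightarrow> stereo (Fin l)"
proof -
  have "1 + (cmod x)\<^sup>2 \<noteq> 0" for x by (metis power_one sum_power2_eq_zero_iff zero_neq_one)
  moreover from this have "complex_of_real (1 + (cmod x)\<^sup>2) \<noteq> 0" for x
    by (metis of_real_eq_0_iff)
  ultimately show ?thesis unfolding stereo.simps by (intro tendsto_intros assms)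
qed

section \<open>Homogeneous coordinates, cross ratios and uniqueness of general limits\<close>

fun hom_coord :: "ext_complex \<Rightarrow> complex \<times> complex" where
  "hom_coord (Fin z) = (z, 1)"
| "hom_coord Infty = (1, 0)"

text \<open>Modulus of the determinant of two homogeneous vectors; a linear map multiplies it by the
  modulus of its own determinant.\<close>

definition cross :: "complex \<times> complex \<Rightarrow> complex \<times> complex \<Rightarrow> real" where
  "cross p q = cmod (fst p * snd q - fst q * snd p)"

lemma chordal_hom: "chordal p q = cross (hom_coord p) (hom_coord q) / (norm (hom_coord p) * norm (hom_coord q))"
  by (cases p; cases q) (simp_all add: cross_def norm_prod_def norm_minus_commute add.commute)

lemma norm_scale_prod: "norm (c * x, c * y) = cmod c * norm (x, y)" for c x y :: complex
  by (simp add: norm_prod_def norm_mult power_mult_distrib real_sqrt_mult flip: distrib_left)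

lemma hom_coord_ext_div:
  assumes "(x, y) \<noteq> (0, 0)"
  shows "\<exists>c. c \<noteq> 0 \<and> (x, y) = (c * fst (hom_coord (ext_div x y)), c * snd (hom_coord (ext_div x y)))"
proof (cases "y = 0")
  case True
  with assms show ?thesis by (intro exI[of _ x]) (simp add: ext_div_def)
next
  case False
  then show ?thesis by (intro exI[of _ y]) (simp add: ext_div_def)
qed

text \<open>The right-hand side is invariant under scaling of either vector, so any homogeneous
  representatives of the two points may be used.\<close>

lemma chordal_ext_div:
  assumes "(x, y) \<noteq> (0, 0)" "(x', y') \<noteq> (0, 0)"
  shows "chordal (ext_div x y) (ext_div x' y') = cross (x, y) (x', y') / (norm (x, y) * norm (x', y'))"
proof -
  obtain c where c: "c \<noteq> 0"
    "(x, y) = (c * fst (hom_coord (ext_div x y)), c * snd (hom_coord (ext_div x y)))"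
    using hom_coord_ext_div[OF assms(1)] by blast
  obtain c' where c': "c' \<noteq> 0"
    "(x', y') = (c' * fst (hom_coord (ext_div x' y')), c' * snd (hom_coord (ext_div x' y')))"
    using hom_coord_ext_div[OF assms(2)] by blast
  define p q where "p = hom_coord (ext_div x y)" "q = hom_coord (ext_div x' y')"
  note pq = this
  have "cross (x, y) (x', y') = cmod ((c * c') * (fst p * snd q - fst q * snd p))"
    unfolding cross_def c(2) c'(2) pq by (simp add: algebra_simps)
  then have "cross (x, y) (x', y') = cmod c * cmod c' * cross p q"
    by (simp add: cross_def norm_mult)
  moreover have "norm (x, y) = cmod c * norm p" "norm (x', y') = cmod c' * norm q"
    unfolding c(2) c'(2) norm_scale_prod pq by simp_all
  ultimately show ?thesis unfolding chordal_hom pq[symmetric] using c(1) c'(1) by simp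
qed

text \<open>For nonvanishing determinant this is the invariance of the cross ratio of \<open>0, \<infinity>, v, w\<close>, combined
  with \<open>chordal 0 \<infinity> = 1\<close> and \<open>chordal \<le> 1\<close>; otherwise the left-hand side vanishes, since \<open>S\<close> is
  constant except at one point.\<close>

lemma chordal_cross_ratio_le:
  fixes A B :: "int \<Rightarrow> complex"
  assumes "B (int n) \<noteq> 0" "B (int n - 1) \<noteq> 0"
  defines "S \<equiv> cf_map A B n"
  shows "chordal (S Infty) (S v) * chordal (S (Fin 0)) (S w) * chordal v w
    \<le> chordal (S (Fin 0)) (S Infty) * chordal (S v) (S w)"
proof -
  define a a' b b' where "a = A (int n)" "a' = A (int n - 1)" "b = B (int n)" "b' = B (int n - 1)"
  note ab = this
  have b: "b \<noteq> 0" "b' \<noteq> 0" using assms by (simp_all add: ab)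
  \<comment> \<open>\<open>X\<close> and \<open>Y\<close> are the coordinates of the linear lift of
    the Moebius map \<open>S\<close>, whose determinant is \<open>D\<close> up to sign.\<close>
  define X where "X p = a * snd (hom_coord p) + a' * fst (hom_coord p)" for p
  define Y where "Y p = b * snd (hom_coord p) + b' * fst (hom_coord p)" for p
  have S: "S p = ext_div (X p) (Y p)" for p
    unfolding S_def by (cases p) (simp_all add: X_def Y_def ab mult.commute)
  define D where "D = a * b' - a' * b"
  show ?thesis
  proof (cases "D = 0")
    case True
    have S0: "S p = Fin (a / b)" if "Y p \<noteq> 0" for p
    proof -
      have "X p * b = a * Y p" using True by (simp add: X_def Y_def D_def algebra_simps)
      then show ?thesis using that b by (simp add: S ext_div_def field_simps)
    qed
    have "Y Infty \<noteq> 0" "Y (Fin 0) \<noteq> 0" using b by (simp_all add: Y_def)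
    then have S1: "S Infty = Fin (a / b)" "S (Fin 0) = Fin (a / b)" using S0 by blast+
    \<comment> \<open>Off the single zero of \<open>Y\<close> the map takes the value
      \<open>a / b\<close>. If both points are that zero, then \<open>v = w\<close> and the last
      factor vanishes; otherwise one of the first two does.\<close>
    have "chordal (S Infty) (S v) * chordal (S (Fin 0)) (S w) * chordal v w = 0"
    proof (cases "Y v = 0 \<and> Y w = 0")
      case True
      have root: "p = Fin (- b / b')" if "Y p = 0" for p
        using that b by (cases p) (auto simp: Y_def field_simps eq_neg_iff_add_eq_0)
      have "v = w" using root[of v] root[of w] True by simp
      then show ?thesis by (cases w) simp_all
    next
      case False
      then have "S v = Fin (a / b) \<or> S w = Fin (a / b)" using S0 by blast
      then show ?thesis using S1 by auto
    qed
    then show ?thesis by (metis chordal_nonneg mult_nonneg_nonneg)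
  next
    case False
    define h where "h p = (X p, Y p)" for p
    have cr: "cross (h p) (h q) = cmod D * cross (hom_coord p) (hom_coord q)" for p q
    proof -
      have "X p * Y q - X q * Y p =
        - D * (fst (hom_coord p) * snd (hom_coord q) - fst (hom_coord q) * snd (hom_coord p))"
        by (simp add: X_def Y_def D_def algebra_simps)
      then show ?thesis by (simp add: cross_def h_def norm_mult)
    qed
    have hc: "hom_coord p \<noteq> 0" for p by (cases p) (simp_all add: zero_prod_def)
    have h0: "h p \<noteq> 0" for p
    proof
      assume "h p = 0"
      then have "X p = 0" "Y p = 0" by (simp_all add: h_def zero_prod_def)
      \<comment> \<open>The adjugate matrix recovers \<open>D * hom_coord p\<close> from
        \<open>h p\<close>.\<close>
      moreover have "D * snd (hom_coord p) = b' * X p - a' * Y p"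
        "D * fst (hom_coord p) = a * Y p - b * X p"
        by (simp_all add: X_def Y_def D_def algebra_simps)
      ultimately show False using hc[of p] False by (simp add: prod_eq_iff)
    qed
    have ch: "chordal (S p) (S q) =
      cmod D * cross (hom_coord p) (hom_coord q) / (norm (h p) * norm (h q))" for p q
    proof -
      have "(X p, Y p) \<noteq> (0, 0)" "(X q, Y q) \<noteq> (0, 0)"
        using h0 by (simp_all add: h_def zero_prod_def)
      then show ?thesis unfolding S cr[symmetric] h_def by (rule chordal_ext_div)
    qed
    define N where "N = (norm (h Infty) * norm (h v)) * (norm (h (Fin 0)) * norm (h w))"
    have N: "N > 0" using h0 by (simp add: N_def)
    define cv where "cv = cross (hom_coord v) (hom_coord w)"
    have "chordal (S Infty) (S v) * chordal (S (Fin 0)) (S w) * chordal v w =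
      ((cmod D)\<^sup>2 * cv / N) *
      ((cross (hom_coord Infty) (hom_coord v) / norm (hom_coord v)) *
       (cross (hom_coord (Fin 0)) (hom_coord w) / norm (hom_coord w)))"
      unfolding ch chordal_hom[of v w] N_def cv_def by (simp add: power2_eq_square)
    also have "\<dots> \<le> ((cmod D)\<^sup>2 * cv / N) * (1 * 1)"
    proof (intro mult_left_mono mult_mono)
      have "cmod (snd p) \<le> norm p" "cmod (fst p) \<le> norm p" for p :: "complex \<times> complex"
        by (metis norm_snd_le norm_fst_le prod.collapse)+
      then show "cross (hom_coord Infty) (hom_coord v) / norm (hom_coord v) \<le> 1"
        "cross (hom_coord (Fin 0)) (hom_coord w) / norm (hom_coord w) \<le> 1"
        by (simp_all add: cross_def divide_le_eq_1 hc)
    qed (use N in \<open>auto simp: cross_def cv_def\<close>)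
    also have "\<dots> = chordal (S (Fin 0)) (S Infty) * chordal (S v) (S w)"
      unfolding ch N_def cv_def by (simp add: cross_def power2_eq_square mult_ac)
    finally show ?thesis .
  qed
qed

text \<open>Passes to the limit in \<open>chordal_cross_ratio_le\<close> along
  \<open>\<phi>\<close>. Both \<open>S j (Fin 0)\<close> and \<open>S j Infty\<close> tend to
  \<open>L\<close>, so the right side tends to 0, while the left side is eventually at least a
  quantity tending to \<open>c\<close> times the squared distance of \<open>L\<close> and
  \<open>l\<close>.\<close>

lemma general_limit_unique:
  assumes vw: "liminf (\<lambda>n. ereal (chordal (v n) (w n))) > 0"
    and v: "(\<lambda>n. chordal (cf_map A B n (v n)) l) \<longlonglongrightarrow> 0"
    and w: "(\<lambda>n. chordal (cf_map A B n (w n)) l) \<longlonglongrightarrow> 0"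
    and \<phi>: "filterlim \<phi> sequentially sequentially"
    and B: "\<And>j. B (int (\<phi> j)) \<noteq> 0" "\<And>j. B (int (\<phi> j) - 1) \<noteq> 0"
    and L: "(\<lambda>j. A (int (\<phi> j)) / B (int (\<phi> j))) \<longlonglongrightarrow> L"
      "(\<lambda>j. A (int (\<phi> j) - 1) / B (int (\<phi> j) - 1)) \<longlonglongrightarrow> L"
  shows "l = Fin L"
proof -
  define S where "S j = cf_map A B (\<phi> j)" for j
  \<comment> \<open>The distances of \<open>v\<close> and \<open>w\<close> need not converge; a
    constant strictly below their liminf replaces them in the limit.\<close>
  obtain c where c: "0 < ereal c" "ereal c < liminf (\<lambda>n. ereal (chordal (v n) (w n)))"
    using ereal_dense2[OF vw] by blast
  have ev: "\<forall>\<^sub>F j in sequentially. chordal (v (\<phi> j)) (w (\<phi> j)) > c"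
    using eventually_compose_filterlim[OF less_LiminfD[OF c(2)] \<phi>] by simp
  have lim: "(\<lambda>j. stereo (S j (Fin 0))) \<longlonglongrightarrow> stereo (Fin L)"
    "(\<lambda>j. stereo (S j Infty)) \<longlonglongrightarrow> stereo (Fin L)"
    using tendsto_stereo_Fin[OF L(1)] tendsto_stereo_Fin[OF L(2)] B
    by (simp_all add: S_def ext_div_def del: stereo.simps)
  have limv: "(\<lambda>j. stereo (S j (v (\<phi> j)))) \<longlonglongrightarrow> stereo l"
    "(\<lambda>j. stereo (S j (w (\<phi> j)))) \<longlonglongrightarrow> stereo l"
    using v w unfolding tendsto_stereo_iff S_def by (intro filterlim_compose[OF _ \<phi>]; simp)+
  have ch: "(\<lambda>j. chordal (p j) (q j)) \<longlonglongrightarrow> chordal a b"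
    if "(\<lambda>j. stereo (p j)) \<longlonglongrightarrow> stereo a" "(\<lambda>j. stereo (q j)) \<longlonglongrightarrow> stereo b" for p q a b
    using tendsto_mult_left[OF tendsto_dist[OF that], of "1 / 2"] by (simp add: dist_stereo)
  have "chordal (Fin L) l * chordal (Fin L) l * c \<le> chordal (Fin L) (Fin L) * chordal l l"
  proof (rule tendsto_le)
    show "(\<lambda>j. chordal (S j Infty) (S j (v (\<phi> j))) * chordal (S j (Fin 0)) (S j (w (\<phi> j))) * c)
      \<longlonglongrightarrow> chordal (Fin L) l * chordal (Fin L) l * c"
      by (intro tendsto_mult ch lim limv tendsto_const)
    show "(\<lambda>j. chordal (S j (Fin 0)) (S j Infty) * chordal (S j (v (\<phi> j))) (S j (w (\<phi> j))))
      \<longlonglongrightarrow> chordal (Fin L) (Fin L) * chordal l l"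
      by (intro tendsto_mult ch lim limv)
    show "\<forall>\<^sub>F j in sequentially.
      chordal (S j Infty) (S j (v (\<phi> j))) * chordal (S j (Fin 0)) (S j (w (\<phi> j))) * c
      \<le> chordal (S j (Fin 0)) (S j Infty) * chordal (S j (v (\<phi> j))) (S j (w (\<phi> j)))"
      using ev
    proof eventually_elim
      case (elim j)
      have "chordal (S j Infty) (S j (v (\<phi> j))) * chordal (S j (Fin 0)) (S j (w (\<phi> j))) * c
        \<le> chordal (S j Infty) (S j (v (\<phi> j))) * chordal (S j (Fin 0)) (S j (w (\<phi> j))) *
          chordal (v (\<phi> j)) (w (\<phi> j))"
        using elim by (intro mult_left_mono mult_nonneg_nonneg chordal_nonneg) auto
      also have "\<dots> \<le> chordal (S j (Fin 0)) (S j Infty) * chordal (S j (v (\<phi> j))) (S j (w (\<phi> j)))"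
        unfolding S_def by (rule chordal_cross_ratio_le[OF B])
      finally show ?case .
    qed
  qed simp
  also have "\<dots> = 0" by simp
  finally have "chordal (Fin L) l * chordal (Fin L) l \<le> 0" using c(1)
    by (simp add: mult_le_0_iff)
  then have "chordal (Fin L) l = 0"
    by (metis dual_order.antisym mult_eq_0_iff zero_le_square)
  then have "stereo (Fin L) = stereo l"
    using dist_stereo[of "Fin L" l] by (simp del: stereo.simps)
  then show ?thesis using stereo_inj by metis
qed

section \<open>Approximants near roots of unity\<close>

lemma continuous_eval_qx:
  assumes "continuous_on S q" "continuous_on S x"
  shows "continuous_on S (\<lambda>\<tau>. eval_qx p (q \<tau>) (x \<tau>))"
  unfolding eval_qx_def
proof (induction p)
  case (pCons c p)
  have "continuous_on S (\<lambda>\<tau>. poly (map_poly of_int c) (q \<tau>))"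
    by (intro continuous_intros assms)
  with pCons show ?case by (simp add: map_poly_pCons) (intro continuous_intros assms)
qed simp

lemma continuous_unit_exp [continuous_intros]:
  "continuous_on S f \<Longrightarrow> continuous_on S (\<lambda>\<tau>. unit_exp (f \<tau>))"
  unfolding unit_exp_def by (intro continuous_intros)

lemma continuous_cf_shift:
  assumes "\<And>n. continuous_on S (\<lambda>\<tau>. a \<tau> n :: complex)" "\<And>n. continuous_on S (\<lambda>\<tau>. b \<tau> n)"
  shows "continuous_on S (\<lambda>\<tau>. cf_num_shift (a \<tau>) (b \<tau>) n)"
    "continuous_on S (\<lambda>\<tau>. cf_den_shift (a \<tau>) (b \<tau>) n)"
  by (induction n rule: induct_nat_012) (auto intro!: continuous_intros assms)

lemma continuous_qcf:
  "continuous_on UNIV (\<lambda>\<tau>. qcf_P k f g (unit_exp \<tau>) n)"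
  "continuous_on UNIV (\<lambda>\<tau>. qcf_Q k f g (unit_exp \<tau>) n)"
  unfolding qcf_P_def qcf_Q_def cf_num_def cf_den_def qcf_a_def qcf_b_def
  by (intro continuous_cf_shift continuous_eval_qx continuous_intros)+

definition H_approx :: "nat \<Rightarrow> (nat \<Rightarrow> int poly poly) \<Rightarrow> (nat \<Rightarrow> int poly poly) \<Rightarrow> rat \<Rightarrow> real \<Rightarrow> int \<Rightarrow> complex" where
  "H_approx k f g \<eta> \<tau> n =
     unit_exp (of_rat \<eta> * \<tau>) * qcf_Q k f g (unit_exp \<tau>) n / qcf_P k f g (unit_exp \<tau>) n"

text \<open>Requiring a nonzero denominator excludes the artefact \<open>x / 0 = 0\<close> and makes
  nearness an open condition on \<open>\<tau>\<close>.\<close>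

definition H_near ::
  "nat \<Rightarrow> (nat \<Rightarrow> int poly poly) \<Rightarrow> (nat \<Rightarrow> int poly poly) \<Rightarrow> rat \<Rightarrow> real \<Rightarrow> int \<Rightarrow> complex \<Rightarrow> real \<Rightarrow> bool" where
  "H_near k f g \<eta> \<tau> n L \<epsilon> \<longleftrightarrow>
     qcf_P k f g (unit_exp \<tau>) n \<noteq> 0 \<and> dist (H_approx k f g \<eta> \<tau> n) L < \<epsilon>"

lemma eventually_H_near:
  assumes G: "G_converges k f g (unit_exp \<tau>)" "G_val k f g (unit_exp \<tau>) \<noteq> 0" and \<epsilon>: "\<epsilon> > 0"
  shows "\<forall>\<^sub>F n::nat in sequentially. H_near k f g \<eta> \<tau> (int n) (H_val k f g \<eta> \<tau>) \<epsilon>"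
proof -
  define P Q where "P = qcf_P k f g (unit_exp \<tau>)" "Q = qcf_Q k f g (unit_exp \<tau>)"
  note PQ = this
  define V where "V = G_val k f g (unit_exp \<tau>)"
  have Q: "\<forall>\<^sub>F n in sequentially. Q (int n) \<noteq> 0"
    and lim: "(\<lambda>n::nat. P (int n) / Q (int n)) \<longlonglongrightarrow> V"
    using G(1) by (simp_all add: G_converges_def cf_converges_def G_val_def cf_value_def PQ V_def
        convergent_LIMSEQ_iff)
  have V: "V \<noteq> 0" using G by (simp add: V_def)
  \<comment> \<open>A nonzero quotient also forces \<open>P (int n) \<noteq> 0\<close>, the
    denominator condition in \<open>H_near\<close>.\<close>
  have ev: "\<forall>\<^sub>F n in sequentially. P (int n) / Q (int n) \<noteq> 0"
    using lim V by (rule tendsto_imp_eventually_ne)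
  have "(\<lambda>n::nat. unit_exp (of_rat \<eta> * \<tau>) * inverse (P (int n) / Q (int n)))
    \<longlonglongrightarrow> unit_exp (of_rat \<eta> * \<tau>) * inverse V"
    by (intro tendsto_intros lim V)
  then have "\<forall>\<^sub>F n::nat in sequentially. dist (unit_exp (of_rat \<eta> * \<tau>) * inverse (P (int n) / Q (int n)))
      (unit_exp (of_rat \<eta> * \<tau>) * inverse V) < \<epsilon>"
    using \<epsilon> by (rule tendstoD)
  with ev show ?thesis
    by eventually_elim (auto simp: H_near_def H_approx_def H_val_def PQ[symmetric] V_def[symmetric] divide_inverse mult_ac)
qed

lemma open_H_near: "open {\<tau>. H_near k f g \<eta> \<tau> n L \<epsilon>}"
proof -
  define U where "U = {\<tau>. qcf_P k f g (unit_exp \<tau>) n \<noteq> 0}"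
  have "open U"
    unfolding U_def by (intro open_Collect_neq continuous_qcf continuous_intros)
  moreover have "continuous_on U (\<lambda>\<tau>. dist (H_approx k f g \<eta> \<tau> n) L)"
    unfolding H_approx_def U_def
    by (intro continuous_intros continuous_on_subset[OF continuous_qcf(1)]
        continuous_on_subset[OF continuous_qcf(2)]) auto
  ultimately have "open ((\<lambda>\<tau>. dist (H_approx k f g \<eta> \<tau> n) L) -` {..<\<epsilon>} \<inter> U)"
    by (subst (asm) continuous_on_open_vimage) auto
  moreover have "(\<lambda>\<tau>. dist (H_approx k f g \<eta> \<tau> n) L) -` {..<\<epsilon>} \<inter> U = {\<tau>. H_near k f g \<eta> \<tau> n L \<epsilon>}"
    by (auto simp: U_def H_near_def)
  ultimately show ?thesis by simp
qed

text \<open>For fixed \<open>n\<close> nearness is open in the angle, so it persists around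
  \<open>\<tau>\<close>. Two consecutive indices are kept because they are the values of
  \<open>S n\<close> at 0 and at infinity.\<close>

lemma H_near_stable:
  assumes G: "G_converges k f g (unit_exp \<tau>)" "G_val k f g (unit_exp \<tau>) \<noteq> 0" and \<epsilon>: "\<epsilon> > 0"
  shows "\<exists>\<delta>>0. \<exists>n\<ge>m. \<forall>\<tau>'. \<bar>\<tau>' - \<tau>\<bar> < \<delta> \<longrightarrow>
    H_near k f g \<eta> \<tau>' (int n) (H_val k f g \<eta> \<tau>) \<epsilon> \<and>
    H_near k f g \<eta> \<tau>' (int n - 1) (H_val k f g \<eta> \<tau>) \<epsilon>"
proof -
  let ?H = "\<lambda>\<tau>' n. H_near k f g \<eta> \<tau>' n (H_val k f g \<eta> \<tau>) \<epsilon>"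
  obtain n0 where n0: "\<And>n. n \<ge> n0 \<Longrightarrow> ?H \<tau> (int n)"
    using eventually_H_near[OF assms] unfolding eventually_sequentially by blast
  define n where "n = Suc (max n0 m)"
  have "?H \<tau> (int n)" "?H \<tau> (int n - 1)"
    using n0[of n] n0[of "max n0 m"] by (simp_all add: n_def)
  then have "\<tau> \<in> {\<tau>'. ?H \<tau>' (int n)} \<inter> {\<tau>'. ?H \<tau>' (int n - 1)}" by simp
  moreover have "open ({\<tau>'. ?H \<tau>' (int n)} \<inter> {\<tau>'. ?H \<tau>' (int n - 1)})"
    by (intro open_Int open_H_near)
  ultimately obtain \<delta> where "\<delta> > 0" "ball \<tau> \<delta> \<subseteq> {\<tau>'. ?H \<tau>' (int n)} \<inter> {\<tau>'. ?H \<tau>' (int n - 1)}"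
    by (metis openE)
  then show ?thesis
    by (intro exI[of _ \<delta>] conjI exI[of _ n]) (auto simp: n_def dist_real_def abs_minus_commute subset_iff)
qed

text \<open>Choosing for each \<open>j\<close> an index \<open>\<phi> j \<ge> j\<close> with error
  below \<open>1 / Suc j\<close> gives the subsequence to which \<open>general_limit_unique\<close>
  applies.\<close>

lemma general_limit_H:
  fixes k :: nat and f g :: "nat \<Rightarrow> int poly poly" and \<eta> :: rat and t :: real
  defines "A \<equiv> \<lambda>t n. unit_exp (of_rat \<eta> * t) * qcf_Q k f g (unit_exp t) n"
    and "B \<equiv> \<lambda>t. qcf_P k f g (unit_exp t)"
  assumes "liminf (\<lambda>n. ereal (chordal (v n) (w n))) > 0"
    "(\<lambda>n. chordal (cf_map (A t) (B t) n (v n)) l) \<longlonglongrightarrow> 0"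
    "(\<lambda>n. chordal (cf_map (A t) (B t) n (w n)) l) \<longlonglongrightarrow> 0"
    and near: "\<And>j::nat. \<exists>n\<ge>j. H_near k f g \<eta> t (int n) L (1 / Suc j) \<and>
       H_near k f g \<eta> t (int n - 1) L (1 / Suc j)"
  shows "l = Fin L"
proof -
  obtain \<phi> where \<phi>: "\<And>j. \<phi> j \<ge> j" "\<And>j. H_near k f g \<eta> t (int (\<phi> j)) L (1 / Suc j)"
    "\<And>j. H_near k f g \<eta> t (int (\<phi> j) - 1) L (1 / Suc j)"
    using near by metis
  have lim: "(\<lambda>j. z j) \<longlonglongrightarrow> L" if "\<And>j. dist (z j) L < 1 / Suc j" for z :: "nat \<Rightarrow> complex"
  proof -
    have "(\<lambda>j. dist (z j) L) \<longlonglongrightarrow> 0"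
    proof (rule tendsto_sandwich)
      show "\<forall>\<^sub>F j in sequentially. 0 \<le> dist (z j) L" by simp
      show "\<forall>\<^sub>F j in sequentially. dist (z j) L \<le> 1 / real (Suc j)"
        using that by (intro always_eventually allI less_imp_le)
      show "(\<lambda>j. 1 / real (Suc j)) \<longlonglongrightarrow> 0" by (rule LIMSEQ_Suc[OF lim_1_over_n])
    qed (rule tendsto_const)
    then show ?thesis by (subst tendsto_dist_iff)
  qed
  show ?thesis
  proof (rule general_limit_unique[where A = "A t" and B = "B t" and \<phi> = \<phi>, OF assms(3-5)])
    show "filterlim \<phi> sequentially sequentially"
      using \<phi>(1) by (intro filterlim_at_top_mono[OF filterlim_ident]) auto
    show "B t (int (\<phi> j)) \<noteq> 0" "B t (int (\<phi> j) - 1) \<noteq> 0" for j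
      using \<phi>(2,3)[of j] by (simp_all add: B_def H_near_def)
    show "(\<lambda>j. A t (int (\<phi> j)) / B t (int (\<phi> j))) \<longlonglongrightarrow> L"
      "(\<lambda>j. A t (int (\<phi> j) - 1) / B t (int (\<phi> j) - 1)) \<longlonglongrightarrow> L"
      using \<phi>(2,3) unfolding A_def B_def H_near_def H_approx_def by (intro lim; blast)+
  qed
qed

section \<open>Diophantine consequences of large partial quotients\<close>

lemma S_diamond_approx:
  assumes \<gamma>: "\<And>m. real (\<gamma> (k * m\<^sup>2)) \<ge> real m ^ 2 + \<Gamma> m" "\<And>m. \<Gamma> m \<ge> 0"
    and t: "0 < t" "t < 1" "t \<notin> \<rat>"
    and big: "real (rcf_quot t (h + 1)) > 2 * pi * real (\<gamma> (k * 1 * (rcf_den t h)\<^sup>2))"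
  shows "h \<le> rcf_den t h" "rcf_den t h \<ge> 1" "rcf_num t h \<le> rcf_den t h"
    "coprime (rcf_num t h) (rcf_den t h)"
    "\<bar>t - rcf_num t h / rcf_den t h\<bar> \<le> 1 / real (rcf_den t h) ^ 4"
    "\<bar>t - rcf_num t h / rcf_den t h\<bar> * \<Gamma> (rcf_den t h) < 1"
proof -
  define m where "m = rcf_den t h"
  define a where "a = real (rcf_quot t (h + 1))"
  have q1: "rcf_quot t (Suc i) \<ge> 1" for i
    by (rule irrational_complete_quotients[OF t(1,3)])
  have q0: "rcf_quot t 0 = 0" using t by (simp add: rcf_quot_def floor_eq_iff)
  show "h \<le> rcf_den t h" unfolding rcf_den_eq by (rule cden_ge[where e = "rcf_quot t", OF q1])
  show m1: "rcf_den t h \<ge> 1" unfolding rcf_den_eq by (rule cden_pos[where e = "rcf_quot t", OF q1])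
  show "rcf_num t h \<le> rcf_den t h" unfolding rcf_den_eq rcf_num_eq by (rule cnum_le_cden[where e = "rcf_quot t", OF q0 q1])
  show "coprime (rcf_num t h) (rcf_den t h)" unfolding rcf_den_eq rcf_num_eq by (rule coprime_cnum_cden)
  have err: "\<bar>t - rcf_num t h / m\<bar> \<le> 1 / (real m ^ 2 * a)"
    using rcf_approx[OF t(1,3), of h] by (simp add: m_def a_def)
  have m: "real m \<ge> 1" using m1 by (simp add: m_def)
  then have m2: "real m ^ 2 \<ge> 1" by (rule one_le_power)
  have "a > 2 * pi * real (\<gamma> (k * m\<^sup>2))" using big by (simp add: a_def m_def)
  moreover have "1 * real (\<gamma> (k * m\<^sup>2)) \<le> 2 * pi * real (\<gamma> (k * m\<^sup>2))"
    using pi_gt3 by (intro mult_right_mono) auto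
  \<comment> \<open>In the error bound \<open>1 / (m ^ 2 * a)\<close> the summand
    \<open>m ^ 2\<close> gives approximation to order 4, and the summand \<open>\<Gamma> m\<close>
    gives closeness at the scale \<open>1 / \<Gamma> m\<close>.\<close>
  ultimately have a: "a > real m ^ 2 + \<Gamma> m" using \<gamma>(1)[of m] by linarith
  have a0: "a > 0" using a m2 \<gamma>(2)[of m] by linarith
  have "1 / (real m ^ 2 * a) \<le> 1 / (real m ^ 2 * real m ^ 2)"
    using a a0 m m2 \<gamma>(2)[of m]
    by (intro divide_left_mono mult_left_mono mult_pos_pos) (linarith | simp)+
  also have "\<dots> = 1 / real m ^ 4" by (simp flip: power_add)
  finally show "\<bar>t - rcf_num t h / rcf_den t h\<bar> \<le> 1 / real (rcf_den t h) ^ 4"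
    using err by (simp add: m_def)
  have "\<bar>t - rcf_num t h / m\<bar> * \<Gamma> m \<le> 1 / (real m ^ 2 * a) * \<Gamma> m"
    using err \<gamma>(2)[of m] by (intro mult_right_mono)
  also have "\<dots> = \<Gamma> m / (real m ^ 2 * a)" by simp
  also have "\<dots> < 1"
  proof -
    have "1 * a \<le> real m ^ 2 * a" using m2 a \<gamma>(2)[of m] by (intro mult_right_mono) auto
    then have "0 < real m ^ 2 * a" "\<Gamma> m < real m ^ 2 * a" using a a0 m2 by linarith+
    then show ?thesis by (subst divide_less_eq_1_pos)
  qed
  finally show "\<bar>t - rcf_num t h / rcf_den t h\<bar> * \<Gamma> (rcf_den t h) < 1" by (simp add: m_def)
qed

lemma S_diamondE:
  assumes "t \<in> S_diamond k d s r u N' \<gamma>"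
  obtains F F' :: "nat \<Rightarrow> nat" where "strict_mono F" "strict_mono F'"
    "\<And>n. [rcf_num t (F n) = r] (mod d) \<and> [rcf_den t (F n) = s] (mod d)"
    "\<And>n. [rcf_num t (F' n) = u] (mod d) \<and> [rcf_den t (F' n) = s] (mod d)"
    "\<And>n. real (rcf_quot t (F n + 1)) > 2 * pi * real (\<gamma> (k * N' * (rcf_den t (F n))\<^sup>2))"
    "\<And>n. real (rcf_quot t (F' n + 1)) > 2 * pi * real (\<gamma> (k * N' * (rcf_den t (F' n))\<^sup>2))"
proof -
  from assms obtain F F' :: "nat \<Rightarrow> nat" where "strict_mono F" "strict_mono F'"
    "\<forall>n. [rcf_num t (F n) = r] (mod d) \<and> [rcf_den t (F n) = s] (mod d)"
    "\<forall>n. [rcf_num t (F' n) = u] (mod d) \<and> [rcf_den t (F' n) = s] (mod d)"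
    "\<forall>n. \<forall>h\<in>{F n, F' n}. real (rcf_quot t (h + 1)) > 2 * pi * real (\<gamma> (k * N' * (rcf_den t h)\<^sup>2))"
    unfolding S_diamond_def by blast
  then show ?thesis by (intro that[of F F']) blast+
qed

lemma S_diamond_null:
  assumes \<gamma>: "\<And>m. real (\<gamma> (k * m\<^sup>2)) \<ge> real m ^ 2"
  shows "unit_exp ` S_diamond k d s r u 1 \<gamma> \<in> null_sets circle_measure"
proof (rule well_approximable_null)
  show "S_diamond k d s r u 1 \<gamma> \<subseteq> {0..<1}" by (auto simp: S_diamond_def)
next
  fix t n assume t: "t \<in> S_diamond k d s r u 1 \<gamma>"
  then obtain F :: "nat \<Rightarrow> nat" where F: "strict_mono F"
    "\<And>n. real (rcf_quot t (F n + 1)) > 2 * pi * real (\<gamma> (k * 1 * (rcf_den t (F n))\<^sup>2))"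
    using S_diamondE by metis
  have t': "0 < t" "t < 1" "t \<notin> \<rat>" using t by (auto simp: S_diamond_def)
  have \<gamma>0: "real (\<gamma> (k * m\<^sup>2)) \<ge> real m ^ 2 + 0" for m using \<gamma> by simp
  note * = S_diamond_approx[OF \<gamma>0 order_refl t' F(2)[of n]]
  have "n \<le> F n" using F(1) by (rule strict_mono_imp_increasing)
  with * show "\<exists>m\<ge>n. \<exists>c\<le>m. \<bar>t - real c / real m\<bar> \<le> 1 / real m ^ 4"
    by (intro exI[of _ "rcf_den t (F n)"] conjI exI[of _ "rcf_num t (F n)"]) auto
qed

lemma exists_gamma:
  fixes k :: nat and \<Gamma> :: "nat \<Rightarrow> real"
  assumes "k \<ge> 1"
  shows "\<exists>\<gamma> :: nat \<Rightarrow> nat. strict_mono \<gamma> \<and> (\<forall>m. real (\<gamma> (k * m\<^sup>2)) \<ge> real m ^ 2 + \<Gamma> m)"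
proof -
  \<comment> \<open>The summand \<open>j\<close> gives strict growth and the term
    \<open>m ^ 2\<close>. Since \<open>m \<le> k * m ^ 2\<close>, the sum up to
    \<open>k * m ^ 2\<close> contains the term for \<open>\<Gamma> m\<close>.\<close>
  define \<gamma> where "\<gamma> j = j + (\<Sum>m\<le>j. nat \<lceil>\<Gamma> m\<rceil>)" for j
  have "strict_mono \<gamma>" by (rule strict_monoI_Suc) (simp add: \<gamma>_def)
  moreover have "real (\<gamma> (k * m\<^sup>2)) \<ge> real m ^ 2 + \<Gamma> m" for m
  proof -
    have 1: "m\<^sup>2 \<le> k * m\<^sup>2" using assms by simp
    moreover have "m \<le> m\<^sup>2" by (simp add: power2_nat_le_imp_le)
    ultimately have "m \<le> k * m\<^sup>2" by linarith
    then have "nat \<lceil>\<Gamma> m\<rceil> \<le> (\<Sum>m\<le>k * m\<^sup>2. nat \<lceil>\<Gamma> m\<rceil>)" by (intro member_le_sum) auto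
    with 1 have "m\<^sup>2 + nat \<lceil>\<Gamma> m\<rceil> \<le> \<gamma> (k * m\<^sup>2)" unfolding \<gamma>_def by linarith
    then have "real (m\<^sup>2) + real (nat \<lceil>\<Gamma> m\<rceil>) \<le> real (\<gamma> (k * m\<^sup>2))" by linarith
    moreover have "\<Gamma> m \<le> real (nat \<lceil>\<Gamma> m\<rceil>)" by linarith
    ultimately show ?thesis by simp
  qed
  ultimately show ?thesis by blast
qed

section \<open>Choice of \<open>\<gamma>\<close> and divergence on the exceptional set\<close>

theorem theorem3:
  fixes k d s r u :: nat
    and f g :: "nat \<Rightarrow> int poly poly"
    and \<eta> :: rat
  assumes k: "k \<ge> 1"
    and d: "d \<ge> 1"
    and s: "1 \<le> s" "s \<le> d"
    and i: "\<And>(m::nat) (h::int) q. m \<ge> 1 \<Longrightarrow> [m = s] (mod d) \<Longrightarrow> coprime h (int m) \<Longrightarrow>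
              q = unit_exp (of_int h / of_nat m) \<Longrightarrow>
              (\<forall>n\<ge>1. qcf_a k f q n \<noteq> 0) \<and> G_converges k f g q \<and> G_val k f g q \<noteq> 0"
    and ii: "\<And>(m::nat) (m'::nat) (h::int) (h'::int).
              m \<ge> 1 \<Longrightarrow> m' \<ge> 1 \<Longrightarrow> coprime h (int m) \<Longrightarrow> coprime h' (int m') \<Longrightarrow>
              [m = m'] (mod d) \<Longrightarrow> [h = h'] (mod int d) \<Longrightarrow>
              G_converges k f g (unit_exp (of_int h / of_nat m)) \<Longrightarrow>
              G_converges k f g (unit_exp (of_int h' / of_nat m'))"
    and iii: "\<And>(m::nat) (m'::nat) (h::int) (h'::int).
              m \<ge> 1 \<Longrightarrow> m' \<ge> 1 \<Longrightarrow> coprime h (int m) \<Longrightarrow> coprime h' (int m') \<Longrightarrow>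
              [m = m'] (mod d) \<Longrightarrow> [h = h'] (mod int d) \<Longrightarrow>
              G_converges k f g (unit_exp (of_int h / of_nat m)) \<Longrightarrow>
              H_val k f g \<eta> (of_int h / of_nat m) = H_val k f g \<eta> (of_int h' / of_nat m')"
    and iv: "\<exists>K0 K1 K2 K3 K4 :: int. \<forall>(m::nat) (h::int) q.
              m \<ge> 1 \<longrightarrow> [m = s] (mod d) \<longrightarrow> coprime h (int m) \<longrightarrow>
              q = unit_exp (of_int h / of_nat m) \<longrightarrow>
                qcf_a k f q (k * m) = of_int K0 \<and>
                qcf_P k f g q (int (k * m) - 1) = of_int K1 \<and>
                qcf_Q k f g q (int (k * m) - 2) = of_int K2 \<and>
                qcf_Q k f g q (int (k * m) - 1) * qcf_P k f g q (int (k * m) - 2) = of_int K3 \<and>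
                cmod (qcf_Q k f g q (int (k * m) - 1)) = of_int K4 \<and>
                cmod (qcf_P k f g q (int (k * m) - 2)) = of_int K4"
    and v: "r < d" "u < d" "r \<noteq> u" "coprime r s" "coprime u s"
           "H_val k f g \<eta> (of_nat r / of_nat s) \<noteq> H_val k f g \<eta> (of_nat u / of_nat s)"
  shows "\<exists>(N'::nat) (\<gamma> :: nat \<Rightarrow> nat). N' \<ge> 1 \<and> strict_mono \<gamma> \<and>
           (\<forall>t \<in> S_diamond k d s r u N' \<gamma>. \<not> H_converges_generally k f g \<eta> t) \<and>
           (let Y = unit_exp ` S_diamond k d s r u N' \<gamma> in
              Y \<subseteq> sphere 0 1 \<and> uncountable Y \<and> Y \<in> null_sets circle_measure)"
proof -
  \<comment> \<open>Index bound and tolerance are both tied to the denominator \<open>m\<close>, so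
    they improve automatically along convergents with growing denominators.\<close>
  define near where "near = (\<lambda>m c \<delta>. \<exists>n\<ge>m. \<forall>\<tau>'. \<bar>\<tau>' - real c / real m\<bar> < \<delta> \<longrightarrow>
    H_near k f g \<eta> \<tau>' (int n) (H_val k f g \<eta> (real c / real m)) (1 / Suc m) \<and>
    H_near k f g \<eta> \<tau>' (int n - 1) (H_val k f g \<eta> (real c / real m)) (1 / Suc m))"
  have "\<exists>\<delta>>0. \<forall>c\<le>m. m \<ge> 1 \<longrightarrow> [m = s] (mod d) \<longrightarrow> coprime c m \<longrightarrow> near m c \<delta>" for m
  proof -
    have "\<exists>\<delta>>0. m \<ge> 1 \<longrightarrow> [m = s] (mod d) \<longrightarrow> coprime c m \<longrightarrow> near m c \<delta>" for c
    proof (cases "m \<ge> 1 \<and> [m = s] (mod d) \<and> coprime c m")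
      case True
      then have "G_converges k f g (unit_exp (real c / real m)) \<and> G_val k f g (unit_exp (real c / real m)) \<noteq> 0"
        using i[of m "int c" "unit_exp (real c / real m)"] by simp
      then show ?thesis
        using H_near_stable[of k f g "real c / real m" "1 / Suc m" m \<eta>] unfolding near_def by auto
    next
      case False
      then show ?thesis by (intro exI[of _ 1]) auto
    qed
    then obtain \<delta> where \<delta>: "\<And>c. \<delta> c > 0"
      "\<And>c. m \<ge> 1 \<Longrightarrow> [m = s] (mod d) \<Longrightarrow> coprime c m \<Longrightarrow> near m c (\<delta> c)"
      by metis
    have mono: "near m c (\<delta> c) \<Longrightarrow> \<delta>' \<le> \<delta> c \<Longrightarrow> near m c \<delta>'" for c \<delta>'
      unfolding near_def by (meson less_le_trans)
    \<comment> \<open>The minimum over the finitely many numerators makes the radius depend on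
      \<open>m\<close> alone, as \<open>\<gamma>\<close> sees only the denominator.\<close>
    have "Min (\<delta> ` {..m}) > 0" using \<delta>(1) by (subst Min_gr_iff) auto
    moreover have "near m c (Min (\<delta> ` {..m}))" if "c \<le> m" "m \<ge> 1" "[m = s] (mod d)" "coprime c m" for c
      using that by (intro mono[OF \<delta>(2)] Min_le) auto
    ultimately show ?thesis by blast
  qed
  then obtain \<delta> where \<delta>: "\<And>m. \<delta> m > 0"
    "\<And>m c. c \<le> m \<Longrightarrow> m \<ge> 1 \<Longrightarrow> [m = s] (mod d) \<Longrightarrow> coprime c m \<Longrightarrow> near m c (\<delta> m)"
    by metis
  \<comment> \<open>With this choice the last conclusion of \<open>S_diamond_approx\<close> says
    exactly that \<open>t\<close> lies within \<open>\<delta> m\<close> of the convergent.\<close>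
  define \<Gamma> where "\<Gamma> m = 1 / \<delta> m" for m
  have \<Gamma>0: "\<Gamma> m \<ge> 0" for m using \<delta>(1)[of m] by (simp add: \<Gamma>_def)
  obtain \<gamma> :: "nat \<Rightarrow> nat" where \<gamma>: "strict_mono \<gamma>" "\<And>m. real (\<gamma> (k * m\<^sup>2)) \<ge> real m ^ 2 + \<Gamma> m"
    using exists_gamma[OF k] by blast
  have limit: "\<exists>n\<ge>j. H_near k f g \<eta> t (int n) (H_val k f g \<eta> (of_nat x / of_nat s)) (1 / Suc j) \<and>
      H_near k f g \<eta> t (int n - 1) (H_val k f g \<eta> (of_nat x / of_nat s)) (1 / Suc j)"
    if t: "0 < t" "t < 1" "t \<notin> \<rat>" and x: "coprime x s" and F: "strict_mono F"
      and cong: "\<And>n. [rcf_num t (F n) = x] (mod d) \<and> [rcf_den t (F n) = s] (mod d)"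
      and big: "\<And>n. real (rcf_quot t (F n + 1)) > 2 * pi * real (\<gamma> (k * 1 * (rcf_den t (F n))\<^sup>2))"
    for t :: real and x j :: nat and F :: "nat \<Rightarrow> nat"
  proof -
    note approx = S_diamond_approx[OF \<gamma>(2) \<Gamma>0 t big[of j]]
    define c m where "c = rcf_num t (F j)" "m = rcf_den t (F j)"
    note cm = this
    have "j \<le> F j" using F by (rule strict_mono_imp_increasing)
    then have jm: "j \<le> m" using approx(1) by (simp add: cm)
    have "\<bar>t - real c / real m\<bar> < \<delta> m"
      using approx(6) \<delta>(1)[of m] by (simp add: cm \<Gamma>_def)
    moreover have "near m c (\<delta> m)"
      using approx(2-4) cong[of j] by (intro \<delta>(2)) (simp_all add: cm)
    ultimately obtain n where n: "n \<ge> m"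
      "H_near k f g \<eta> t (int n) (H_val k f g \<eta> (real c / real m)) (1 / Suc m)"
      "H_near k f g \<eta> t (int n - 1) (H_val k f g \<eta> (real c / real m)) (1 / Suc m)"
      unfolding near_def by blast
    \<comment> \<open>The convergent and \<open>x / s\<close> agree modulo \<open>d\<close> in
      numerator and denominator, so assumption \<open>iii\<close> gives the same value of
      \<open>H\<close> for all convergents of the subsequence.\<close>
    have "H_val k f g \<eta> (real c / real m) = H_val k f g \<eta> (real x / real s)"
    proof -
      have "G_converges k f g (unit_exp (real c / real m))"
        using i[of m "int c" "unit_exp (real c / real m)"] approx(2,4) cong[of j] by (simp add: cm)
      then show ?thesis
        using iii[of m s "int c" "int x"] approx(2,4) cong[of j] x s by (simp add: cm cong_int_iff)
    qed
    moreover have "1 / real (Suc m) \<le> 1 / real (Suc j)" using jm by (intro divide_left_mono) auto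
    ultimately show ?thesis using n jm by (intro exI[of _ n]) (auto simp: H_near_def)
  qed
  have div: "\<not> H_converges_generally k f g \<eta> t" if tS: "t \<in> S_diamond k d s r u 1 \<gamma>" for t
  proof
    assume "H_converges_generally k f g \<eta> t"
    then obtain l v w where lvw:
      "liminf (\<lambda>n. ereal (chordal (v n) (w n))) > 0"
      "(\<lambda>n. chordal (cf_map (\<lambda>n. unit_exp (of_rat \<eta> * t) * qcf_Q k f g (unit_exp t) n)
         (qcf_P k f g (unit_exp t)) n (v n)) l) \<longlonglongrightarrow> 0"
      "(\<lambda>n. chordal (cf_map (\<lambda>n. unit_exp (of_rat \<eta> * t) * qcf_Q k f g (unit_exp t) n)
         (qcf_P k f g (unit_exp t)) n (w n)) l) \<longlonglongrightarrow> 0"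
      unfolding H_converges_generally_def converges_generally_def by blast
    have t: "0 < t" "t < 1" "t \<notin> \<rat>" using tS by (auto simp: S_diamond_def)
    obtain F F' :: "nat \<Rightarrow> nat" where F: "strict_mono F" "strict_mono F'"
      "\<And>n. [rcf_num t (F n) = r] (mod d) \<and> [rcf_den t (F n) = s] (mod d)"
      "\<And>n. [rcf_num t (F' n) = u] (mod d) \<and> [rcf_den t (F' n) = s] (mod d)"
      "\<And>n. real (rcf_quot t (F n + 1)) > 2 * pi * real (\<gamma> (k * 1 * (rcf_den t (F n))\<^sup>2))"
      "\<And>n. real (rcf_quot t (F' n + 1)) > 2 * pi * real (\<gamma> (k * 1 * (rcf_den t (F' n))\<^sup>2))"
      using S_diamondE[OF tS] by metis
    have "l = Fin (H_val k f g \<eta> (of_nat r / of_nat s))"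
      by (rule general_limit_H[OF lvw limit[OF t v(4) F(1,3,5)]])
    moreover have "l = Fin (H_val k f g \<eta> (of_nat u / of_nat s))"
      by (rule general_limit_H[OF lvw limit[OF t v(5) F(2,4,6)]])
    ultimately show False using v(6) by simp
  qed
  have \<gamma>2: "real (\<gamma> (k * m\<^sup>2)) \<ge> real m ^ 2" for m using \<gamma>(2)[of m] \<Gamma>0[of m] by linarith
  have "inj_on unit_exp (S_diamond k d s r u 1 \<gamma>)"
    by (rule inj_on_subset[OF inj_on_unit_exp]) (auto simp: S_diamond_def)
  then have "uncountable (unit_exp ` S_diamond k d s r u 1 \<gamma>)"
    using S_diamond_uncountable[OF d v(4,5)] by (metis countable_image_inj_on)
  moreover have "unit_exp ` S_diamond k d s r u 1 \<gamma> \<subseteq> sphere 0 1" by (auto simp: unit_exp_eq_cis)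
  moreover have "unit_exp ` S_diamond k d s r u 1 \<gamma> \<in> null_sets circle_measure"
    by (rule S_diamond_null[OF \<gamma>2])
  ultimately show ?thesis using \<gamma>(1) div
    unfolding Let_def by (intro exI[of _ 1] exI[of _ \<gamma>]) auto
qed

end
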